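(* Suppose that $\tau=(\tau_1,\dots,\tau_d),\ \tau'=(\tau'_1,\dots,\tau'_d)\in(0,\infty)^d$, $g\in\mathcal{O}_{\tau'}^{\tau}(\mathbb{C}^d)$, $\Lambda_l:=\{\pm\lambda_{n,l}: n\ge 1\}$ and $\tilde\Lambda_l:=\{\pm\tilde\lambda_{n,l}: n\ge 1\}$, where $\{\lambda_{n,l}: n\ge 1\}$ and $\{\tilde\lambda_{n,l}: n\ge 1\}$ are increasing sequences of positive numbers, $1\le l\le d$, and $$\Lambda=\prod_{l=1}^d\Lambda_l\times\prod_{l=1}^d\tilde\Lambda_l.$$ If the limits $a_l:=\lim_{n\to\infty}\frac{\lambda_{n,l}}{n^{1/2}}$ and $b_l:=\lim_{n\to\infty}\frac{\tilde\lambda_{n,l}}{n^{1/2}}$ exist for all $1\le l\le d$ and $$a_l<\sqrt{\frac{\pi}{\tau_l}},\qquad b_l<\sqrt{\frac{\tau'_l}{\pi}},\qquad 1\le l\le d,$$ then $\Lambda$ does phase retrieval with respect to the window function $g$.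
   Context: For $\tau,\tau'\in(0,\infty)^d$, $\mathcal{O}_{\tau'}^{\tau}(\mathbb{C}^d)$ is the set of all entire functions $f$ on $\mathbb{C}^d$ for which there is a constant $C$ with $|f(x+iy)|\le C\prod_{l=1}^d e^{-\tau'_l x_l^2}e^{\tau_l y_l^2}$ for all $x+iy\in\mathbb{C}^d$ (with $x,y\in\mathbb{R}^d$). For a window function $g$ (restricted to $\mathbb{R}^d$) and $f\in L^2(\mathbb{R}^d)$, the short time Fourier transform is $V_gf(t,\omega)=\int_{\mathbb{R}^d} f(x)\overline{g(x-t)}e^{-2\pi i\langle x,\omega\rangle}\,dx$, $t,\omega\in\mathbb{R}^d$. A set $\Lambda\subset\mathbb{R}^{2d}$ does phase retrieval with respect to $g$ if, for all $f_1,f_2\in L^2(\mathbb{R}^d)$, the condition $|V_gf_1(t,\omega)|=|V_gf_2(t,\omega)|$ for all $(t,\omega)\in\Lambda$ implies that there is a real constant $\alpha$ with $f_1=e^{i\alpha}f_2$ almost everywhere.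
   Formalization: The window g is assumed not identically zero; for g = 0, which belongs to the stated class, every short time Fourier transform vanishes and the claim fails. *)

theory Defs
  imports "HOL-Analysis.Analysis"
begin

definition complex_vec :: "real ^ 'd \<Rightarrow> real ^ 'd \<Rightarrow> complex ^ 'd" where
  "complex_vec x y = (\<chi> l. Complex (x $ l) (y $ l))"

text \<open>
  Entire functions of several complex variables: at every point the (real) Frechet derivative
  exists and is complex-linear.  Additivity of \<open>D\<close> is part of \<open>has_derivative\<close>.
\<close>
definition entire :: "(complex ^ 'd \<Rightarrow> complex) \<Rightarrow> bool" where
  "entire f \<longleftrightarrow>
     (\<forall>z. \<exists>D. (f has_derivative D) (at z) \<and> (\<forall>(c::complex) v. D (c *s v) = c * D v))"

definition gauss_entire :: "real ^ 'd \<Rightarrow> real ^ 'd \<Rightarrow> (complex ^ 'd \<Rightarrow> complex) set" where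
  "gauss_entire \<tau>' \<tau> =
     {f. entire f \<and>
         (\<exists>C::real. \<forall>x y. cmod (f (complex_vec x y)) \<le>
            C * (\<Prod>l\<in>UNIV. exp (- (\<tau>' $ l) * (x $ l)\<^sup>2) * exp (\<tau> $ l * (y $ l)\<^sup>2)))}"

text \<open>Elements of \<open>L\<^sup>2\<close> are represented by functions; they are compared almost everywhere.\<close>
definition L2_fun :: "(real ^ 'd \<Rightarrow> complex) set" where
  "L2_fun = {f. f \<in> borel_measurable lebesgue \<and> integrable lebesgue (\<lambda>x. (cmod (f x))\<^sup>2)}"

definition STFT ::
    "(real ^ 'd \<Rightarrow> complex) \<Rightarrow> (real ^ 'd \<Rightarrow> complex) \<Rightarrow> real ^ 'd \<Rightarrow> real ^ 'd \<Rightarrow> complex" where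
  "STFT g f t \<omega> =
     (LINT x|lebesgue. f x * cnj (g (x - t)) * exp (- 2 * of_real pi * \<i> * of_real (x \<bullet> \<omega>)))"

text \<open>\<open>\<real>\<^bsup>2d\<^esup>\<close> is rendered as \<open>\<real>\<^bsup>d\<^esup> \<times> \<real>\<^bsup>d\<^esup>\<close>.\<close>
definition does_phase_retrieval ::
    "(real ^ 'd \<Rightarrow> complex) \<Rightarrow> ((real ^ 'd) \<times> (real ^ 'd)) set \<Rightarrow> bool" where
  "does_phase_retrieval g \<Lambda> \<longleftrightarrow>
     (\<forall>f1\<in>L2_fun. \<forall>f2\<in>L2_fun.
        (\<forall>(t, \<omega>)\<in>\<Lambda>. cmod (STFT g f1 t \<omega>) = cmod (STFT g f2 t \<omega>)) \<longrightarrow>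
        (\<exists>\<alpha>::real. AE x in lebesgue. f1 x = exp (\<i> * of_real \<alpha>) * f2 x))"

definition sym_range :: "(nat \<Rightarrow> real) \<Rightarrow> real set" where
  "sym_range s = {s n | n. n \<ge> 1} \<union> {- s n | n. n \<ge> 1}"

definition product_set ::
    "('d \<Rightarrow> real set) \<Rightarrow> ('d \<Rightarrow> real set) \<Rightarrow> ((real ^ 'd) \<times> (real ^ 'd)) set" where
  "product_set A B = {x. \<forall>l. x $ l \<in> A l} \<times> {x. \<forall>l. x $ l \<in> B l}"

end

(*
  The short time Fourier transform V of f extends to an entire function of (t, omega) in C^2d, and
  F(t, omega) = V(t, omega) * cnj (V (cnj t, cnj omega)) equals |V|^2 at real points. In each single
  variable, the others being real, F is entire and bounded by C exp(2 s y^2), where s is tau_l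
  or pi^2 / tau'_l. Such a function with zeros lambda_n, lim lambda_n / sqrt n < sqrt (pi / s), vanishes:
  with w = z^2 this is a Carlson type theorem in the right half plane. Hence |V f1| = |V f2| on Lambda
  propagates, one variable after the other, to all real points.

  For fixed t the function |V f(t, .)|^2 is the Fourier transform of the autocorrelation of
  f * cnj g(. - t). Injectivity of the Fourier transform, used once in omega and once in t (where the
  transform of x |-> cnj g(x + s) g(x) is real analytic and nonzero, hence nonzero on a dense set), yields
  f1(x) cnj f1(y) = f2(x) cnj f2(y) for almost all x, y, that is, equality up to a phase.
*)
theory Submission
  imports
    Defs
    "HOL-Complex_Analysis.Complex_Analysis"
    "HOL-Probability.Probability"
    "HOL-Real_Asymp.Real_Asymp"
begin

no_notation fps_nth (infixl "$" 75)

section \<open>A uniqueness theorem for entire functions of order two\<close>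

text \<open>The thresholds come from a comparison of densities. Under w = z^2 the bound 2 s y^2
  turns into s (|w| - Re w), which is exponential type s on the imaginary w-axis; such growth
  tolerates zeros of density at most s / pi. The points lambda_n^2 ~ a^2 n have density 1 / a^2
  (infinite if a = 0), so a < sqrt (pi / s) says that there are too many of them. The rate pi^2 /
  tau' for omega appears when the square is completed in - tau' x^2 + 2 pi x Im omega, and sqrt (pi
  / s) then becomes sqrt (tau' / pi). Several complex variables enter only through restrictions to
  complex lines, where the identity theorem of one variable is available. Null sets shape the second
  half: the identity of autocorrelations holds for almost every shift, with an exceptional set that
  depends on t. The quantifiers have to be exchanged before a Fourier transform in t can be taken,
  and once more before shifts are turned back into pairs of points. The condition g \<noteq> 0
  enters through the dense set on which the transform of the window product is nonzero: for g = 0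
  the short time Fourier transform carries no information.\<close>

lemma holomorphic_zero_near_0:
  assumes "h holomorphic_on UNIV" "e > 0" "\<And>r. 0 < r \<Longrightarrow> r < e \<Longrightarrow> h (complex_of_real r) = 0"
  shows "h z = 0"
proof (rule analytic_continuation[OF assms(1), of "complex_of_real ` {0<..<e}" 0])
  show "0 islimpt complex_of_real ` {0<..<e}"
    unfolding islimpt_approachable
  proof safe
    fix d :: real assume "d > 0"
    then show "\<exists>x'\<in>complex_of_real ` {0<..<e}. x' \<noteq> 0 \<and> dist x' 0 < d"
      using assms(2)
      by (intro bexI[of _ "of_real (min e d / 2)"] imageI) (auto simp: min_def norm_divide)
  qed
qed (use assms(3) in auto)

lemma holomorphic_divide_zeros:
  fixes h :: "complex \<Rightarrow> complex"
  assumes "finite Z" "h holomorphic_on UNIV" "\<And>p. p \<in> Z \<Longrightarrow> h p = 0"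
  shows "\<exists>q. q holomorphic_on UNIV \<and> (\<forall>z. h z = q z * (\<Prod>p\<in>Z. z - p))"
  using assms
proof (induction Z rule: finite_induct)
  case empty
  then show ?case by (intro exI[of _ h]) auto
next
  case (insert a Z)
  then obtain q where q: "q holomorphic_on UNIV" "\<And>z. h z = q z * (\<Prod>p\<in>Z. z - p)"
    by auto
  have qa: "q a = 0"
    using insert.prems(2)[of a] q(2)[of a] insert.hyps by (auto simp: prod_zero_iff)
  define r where "r z = (if z = a then deriv q a else q z / (z - a))" for z
  have "r holomorphic_on UNIV"
    by (rule pole_theorem_open_0[OF q(1), where a = a]) (auto simp: r_def qa)
  moreover have "h z = r z * (\<Prod>p\<in>insert a Z. z - p)" for z
    using insert.hyps qa by (auto simp: q(2) r_def)
  ultimately show ?case by blast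
qed

section \<open>Estimates for the logarithmic multiplier and for Blaschke factors\<close>

lemma half_pi_minus_inverse_le_arctan:
  fixes s :: real
  assumes "s > 0"
  shows "pi / 2 - 1 / s \<le> arctan s"
proof -
  have "arctan (1 / s) = pi / 2 - arctan s"
    using arctan_inverse[of s] assms by (simp add: inverse_eq_divide)
  moreover have "arctan (1 / s) \<le> 1 / s"
    using assms by (intro arctan_le_self) auto
  ultimately show ?thesis by linarith
qed

text \<open>The argument of \<open>1 + w\<close> falls short of a right angle by at most
  \<open>(1 + Re w) / \<bar>Im w\<bar>\<close>, so \<open>- Im w * Im (Ln (1 + w))\<close> is close
  to \<open>- pi / 2 * \<bar>Im w\<bar>\<close>. A multiplier built from
  \<open>w * Ln (1 + w)\<close> therefore decays at a fixed rate along the imaginary axis and costs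
  only a logarithm along the real one. The shift by 1 keeps the logarithm regular at
  \<open>w = 0\<close>.\<close>

lemma Re_mult_Ln_Suc_le:
  fixes w :: complex
  assumes "Re w \<ge> 0" "cmod w \<le> R"
  shows "Re (w * Ln (1 + w)) \<le> Re w * ln (1 + R) - pi / 2 * \<bar>Im w\<bar> + 1 + Re w"
proof -
  have ne: "1 + w \<noteq> 0" using assms(1) by (auto simp: complex_eq_iff)
  have im: "Im (Ln (1 + w)) = arctan (Im w / (1 + Re w))"
    using assms(1) by (subst Im_Ln_eq) (auto simp: ne)
  have "cmod (1 + w) \<le> 1 + R" using assms(2) norm_triangle_ineq[of 1 w] by simp
  then have re: "Re (Ln (1 + w)) \<le> ln (1 + R)"
    using ne by (simp add: ln_mono)
  have "pi / 2 * \<bar>Im w\<bar> - (1 + Re w) \<le> Im w * arctan (Im w / (1 + Re w))"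
  proof (cases "Im w = 0")
    case False
    have "Im w * arctan (Im w / (1 + Re w)) = \<bar>Im w\<bar> * arctan (\<bar>Im w\<bar> / (1 + Re w))"
      by (cases "Im w \<ge> 0") (auto simp: arctan_minus)
    moreover have "pi / 2 - 1 / (\<bar>Im w\<bar> / (1 + Re w)) \<le> arctan (\<bar>Im w\<bar> / (1 + Re w))"
      using assms(1) False by (intro half_pi_minus_inverse_le_arctan) auto
    then have "\<bar>Im w\<bar> * (pi / 2 - 1 / (\<bar>Im w\<bar> / (1 + Re w))) \<le> \<bar>Im w\<bar> * arctan (\<bar>Im w\<bar> / (1 + Re w))"
      by (intro mult_left_mono) auto
    moreover have "\<bar>Im w\<bar> * (pi / 2 - 1 / (\<bar>Im w\<bar> / (1 + Re w))) = pi / 2 * \<bar>Im w\<bar> - (1 + Re w)"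
      using False by (simp add: field_simps)
    ultimately show ?thesis by simp
  qed (use assms(1) in auto)
  moreover have "Re w * Re (Ln (1 + w)) \<le> Re w * ln (1 + R)"
    using re assms(1) by (intro mult_left_mono) auto
  ultimately show ?thesis by (simp add: im)
qed

lemma exp_neg_double_le_one_minus:
  fixes s :: real
  assumes "0 \<le> s" "s \<le> 1 / 2"
  shows "exp (- 2 * s) \<le> 1 - s"
proof -
  have "- s - 2 * s\<^sup>2 \<le> ln (1 - s)"
    using assms by (intro ln_one_minus_pos_lower_bound) auto
  moreover have "2 * s\<^sup>2 \<le> s" using assms mult_left_mono[of "2 * s" 1 s] by (simp add: power2_eq_square)
  ultimately have "- 2 * s \<le> ln (1 - s)" by linarith
  then have "exp (- 2 * s) \<le> exp (ln (1 - s))" by (subst exp_le_cancel_iff)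
  then show ?thesis using assms by simp
qed

text \<open>The squared moduli of \<open>m + w\<close> and \<open>m - w\<close> differ by
  \<open>4 * m * Re w\<close>, and \<open>R\<^sup>2 \<le> (cmod (m + w))\<^sup>2\<close>, so their
  quotient is at least \<open>1 - s\<close> with \<open>s = 4 * m * Re w / R\<^sup>2\<close>. The
  room in \<open>8 * m \<le> R\<close> gives \<open>s \<le> 1 / 2\<close>, where
  \<open>1 - s \<ge> exp (- 2 * s)\<close>. The loss is exponential in \<open>Re w\<close>, so a
  factor \<open>exp (- k * w)\<close> can pay for it.\<close>

lemma blaschke_factor_lower:
  fixes w :: complex and m R :: real
  assumes "Re w \<ge> 0" "cmod w = R" "m > 0" "8 * m \<le> R"
  shows "cmod (m + w) \<le> cmod (m - w) * exp (4 * m * Re w / R\<^sup>2)"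
proof -
  have R: "R > 0" using assms by linarith
  have sq: "(cmod (m + w))\<^sup>2 = m\<^sup>2 + 2 * m * Re w + R\<^sup>2" "(cmod (m - w))\<^sup>2 = m\<^sup>2 - 2 * m * Re w + R\<^sup>2"
    unfolding assms(2)[symmetric] cmod_power2 by (auto simp: power2_eq_square algebra_simps)
  define s where "s = 4 * m * Re w / R\<^sup>2"
  have "Re w \<le> R" using assms(2) complex_Re_le_cmod[of w] by simp
  then have "8 * m * Re w \<le> R * R" using assms R by (intro mult_mono) auto
  then have s: "0 \<le> s" "s \<le> 1/2" using assms R by (auto simp: s_def field_simps power2_eq_square)
  have sR: "4 * m * Re w = s * R\<^sup>2" using R by (simp add: s_def)
  have "(cmod (m + w))\<^sup>2 * exp (- 2 * s) \<le> (cmod (m + w))\<^sup>2 * (1 - s)"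
    by (intro mult_left_mono exp_neg_double_le_one_minus s) auto
  also have "\<dots> \<le> (cmod (m - w))\<^sup>2"
  proof -
    have "s * R\<^sup>2 \<le> s * (cmod (m + w))\<^sup>2"
      using assms s unfolding sq by (intro mult_left_mono) auto
    then show ?thesis using sR unfolding sq by (simp add: algebra_simps)
  qed
  finally have "(cmod (m + w))\<^sup>2 * exp (- 2 * s) * exp (2 * s) \<le> (cmod (m - w))\<^sup>2 * exp (2 * s)"
    by (intro mult_right_mono) auto
  then have "(cmod (m + w))\<^sup>2 \<le> (cmod (m - w) * exp s)\<^sup>2"
    by (simp add: power_mult_distrib exp_double mult.assoc exp_minus)
  then show ?thesis unfolding s_def by (rule power2_le_imp_le) auto
qed

text \<open>Maximum principle on the sector \<open>\<bar>arg z\<bar> \<le> pi / 4\<close>, \<open>\<bar>z\<bar>\<^sup>2 \<le> R\<close> for \<open>h\<close>, divided by the Blaschke factors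
  \<open>(p\<^sup>2 - w) / (p\<^sup>2 + w)\<close> and multiplied by \<open>exp (2 \<sigma> / pi * w * Ln (1 + w) - k w)\<close>, where \<open>w = z\<^sup>2\<close>. The
  real part of the exponent is about \<open>- \<sigma> * \<bar>w\<bar>\<close> for imaginary \<open>w\<close>, which compensates the growth of \<open>h\<close>
  there; \<open>k\<close> is chosen such that the product is also bounded on the arc.\<close>
lemma sector_zero_bound:
  fixes h :: "complex \<Rightarrow> complex" and C \<sigma> R x :: real and Z :: "real set"
  assumes hol: "h holomorphic_on UNIV"
    and bd: "\<And>z. cmod (h z) \<le> C * exp (2 * \<sigma> * (Im z)\<^sup>2)"
    and \<sigma>: "\<sigma> > 0" and Z: "finite Z" "\<And>p. p \<in> Z \<Longrightarrow> p > 0" "\<And>p. p \<in> Z \<Longrightarrow> h (of_real p) = 0"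
    and R: "\<And>p. p \<in> Z \<Longrightarrow> 8 * p\<^sup>2 \<le> R" and x: "x > 0" "x\<^sup>2 \<le> R"
    and k: "k = 2 * \<sigma> / pi * ln (1 + R) + \<sigma> * (1 + 2 / pi) + (\<Sum>p\<in>Z. 4 * p\<^sup>2 / R\<^sup>2)"
  shows "cmod (h (of_real x)) \<le> C * exp (2 * \<sigma> / pi + k * x\<^sup>2) * (\<Prod>p\<in>Z. \<bar>p\<^sup>2 - x\<^sup>2\<bar> / (p\<^sup>2 + x\<^sup>2))"
proof -
  have C: "C \<ge> 0" using order_trans[OF norm_ge_zero bd[of 0]] by simp
  have "\<exists>q. q holomorphic_on UNIV \<and> (\<forall>z. h z = q z * (\<Prod>p\<in>complex_of_real ` Z. z - p))"
    using Z hol by (intro holomorphic_divide_zeros) auto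
  then obtain q where q: "q holomorphic_on UNIV" "\<And>z. h z = q z * (\<Prod>p\<in>complex_of_real ` Z. z - p)"
    by auto
  have hq: "h z = q z * (\<Prod>p\<in>Z. z - of_real p)" for z
    unfolding q(2) by (subst prod.reindex) (auto simp: inj_on_def)
  define E where "E z = exp (of_real (2 * \<sigma> / pi) * (z\<^sup>2 * Ln (1 + z\<^sup>2)) - of_real k * z\<^sup>2)" for z :: complex
  \<comment> \<open>Up to sign this is \<open>h * E\<close> divided by the Blaschke product, with
    the factors \<open>z - p\<close> already cancelled against zeros of \<open>h\<close>, so that no
    singularity remains at the points \<open>p\<close>. \<open>GB\<close> below is the division-free
    form of this relation for moduli.\<close>
  define G where "G z = q z * E z * (\<Prod>p\<in>Z. (of_real (p\<^sup>2) + z\<^sup>2) / (z + of_real p))" for z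
  define S where "S = {z. Re z \<ge> 0 \<and> Re (z\<^sup>2) \<ge> 0 \<and> (cmod z)\<^sup>2 \<le> R}"
  \<comment> \<open>The total loss of the Blaschke factors on the arc, as a rate in
    \<open>Re (z\<^sup>2)\<close>; it is the last summand of \<open>k\<close>.\<close>
  define \<kappa> where "\<kappa> = (\<Sum>p\<in>Z. 4 * p\<^sup>2 / R\<^sup>2)"
  have hE: "cmod (h z) * cmod (E z) \<le> C * exp (2 * \<sigma> / pi) * exp (- \<kappa> * Re (z\<^sup>2))" if "z \<in> S" for z
  proof -
    define w where "w = z\<^sup>2"
    have w: "Re w \<ge> 0" "cmod w \<le> R" using that by (auto simp: S_def w_def norm_power)
    \<comment> \<open>This makes the quadratic growth in \<open>Im z\<close> linear in
      \<open>w\<close>: it equals \<open>\<sigma> * (cmod w - Re w)\<close>, hence is at most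
      \<open>\<sigma> * \<bar>Im w\<bar>\<close>, which the logarithmic term removes.\<close>
    have im: "2 * (Im z)\<^sup>2 = cmod w - Re w"
      unfolding w_def norm_power cmod_power2 by (simp add: power2_eq_square)
    have "cmod w \<le> Re w + \<bar>Im w\<bar>" using cmod_le[of w] w by simp
    moreover have "2 * \<sigma> / pi * Re (w * Ln (1 + w)) \<le> 2 * \<sigma> / pi * (Re w * ln (1 + R) - pi / 2 * \<bar>Im w\<bar> + 1 + Re w)"
      using \<sigma> by (intro mult_left_mono Re_mult_Ln_Suc_le w) auto
    then have "2 * \<sigma> / pi * Re (w * Ln (1 + w)) \<le> 2 * \<sigma> / pi * (Re w * ln (1 + R)) - \<sigma> * \<bar>Im w\<bar> + 2 * \<sigma> / pi + 2 * \<sigma> / pi * Re w"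
      by (simp add: algebra_simps)
    moreover have "\<sigma> * cmod w \<le> \<sigma> * (Re w + \<bar>Im w\<bar>)" using calculation \<sigma> by (intro mult_left_mono) auto
    moreover have "\<sigma> * Re w \<ge> 0" using w \<sigma> by simp
    moreover have "k * Re w = 2 * \<sigma> / pi * (Re w * ln (1 + R)) + \<sigma> * Re w + 2 * \<sigma> / pi * Re w + \<kappa> * Re w"
      unfolding k \<kappa>_def[symmetric] by (simp add: algebra_simps)
    ultimately have *: "2 * \<sigma> * (Im z)\<^sup>2 + (2 * \<sigma> / pi * Re (w * Ln (1 + w)) - k * Re w) \<le> 2 * \<sigma> / pi - \<kappa> * Re w"
      using arg_cong[OF im, of "(*) \<sigma>"] by (simp add: algebra_simps)
    have E: "cmod (E z) = exp (2 * \<sigma> / pi * Re (w * Ln (1 + w)) - k * Re w)"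
      unfolding E_def norm_exp_eq_Re w_def[symmetric] minus_complex.sel times_complex.sel by simp
    have "cmod (h z) * cmod (E z) \<le> C * exp (2 * \<sigma> * (Im z)\<^sup>2) * exp (2 * \<sigma> / pi * Re (w * Ln (1 + w)) - k * Re w)"
      unfolding E by (intro mult_right_mono bd) auto
    also have "\<dots> = C * exp (2 * \<sigma> * (Im z)\<^sup>2 + (2 * \<sigma> / pi * Re (w * Ln (1 + w)) - k * Re w))"
      by (simp add: exp_add mult.assoc)
    also have "\<dots> \<le> C * exp (2 * \<sigma> / pi - \<kappa> * Re w)"
      using * C by (intro mult_left_mono) auto
    also have "\<dots> = C * exp (2 * \<sigma> / pi) * exp (- \<kappa> * Re (z\<^sup>2))"
      unfolding w_def[symmetric] mult.assoc exp_add[symmetric] by simp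
    finally show ?thesis .
  qed
  have GB: "cmod (G z) * (\<Prod>p\<in>Z. cmod (of_real (p\<^sup>2) - z\<^sup>2)) = cmod (h z) * cmod (E z) * (\<Prod>p\<in>Z. cmod (of_real (p\<^sup>2) + z\<^sup>2))"
    if "Re z \<ge> 0" for z
  proof -
    have "(of_real (p\<^sup>2) + z\<^sup>2) / (z + of_real p) * (of_real (p\<^sup>2) - z\<^sup>2) = (of_real p - z) * (of_real (p\<^sup>2) + z\<^sup>2)" if "p \<in> Z" for p
    proof -
      have "z + of_real p \<noteq> 0" using \<open>Re z \<ge> 0\<close> Z(2)[OF that] by (auto simp: complex_eq_iff)
      then show ?thesis by (simp add: field_simps power2_eq_square)
    qed
    then have "(\<Prod>p\<in>Z. (of_real (p\<^sup>2) + z\<^sup>2) / (z + of_real p)) * (\<Prod>p\<in>Z. of_real (p\<^sup>2) - z\<^sup>2)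
      = (\<Prod>p\<in>Z. of_real p - z) * (\<Prod>p\<in>Z. of_real (p\<^sup>2) + z\<^sup>2)"
      unfolding prod.distrib[symmetric] by (intro prod.cong) auto
    then have "cmod (\<Prod>p\<in>Z. (of_real (p\<^sup>2) + z\<^sup>2) / (z + of_real p)) * (\<Prod>p\<in>Z. cmod (of_real (p\<^sup>2) - z\<^sup>2))
      = (\<Prod>p\<in>Z. cmod (of_real p - z)) * (\<Prod>p\<in>Z. cmod (of_real (p\<^sup>2) + z\<^sup>2))"
      unfolding prod_norm norm_mult[symmetric] by simp
    moreover have "(\<Prod>p\<in>Z. cmod (of_real p - z)) = (\<Prod>p\<in>Z. cmod (z - of_real p))"
      by (simp add: norm_minus_commute)
    ultimately show ?thesis
      unfolding G_def hq norm_mult by (simp add: prod_norm mult_ac)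
  qed
  have opn: "G holomorphic_on {z. Re z > 0 \<and> Re (z\<^sup>2) > 0}"
    unfolding G_def E_def
    by (intro holomorphic_intros holomorphic_on_subset[OF q(1)])
       (use Z in \<open>force simp: complex_nonpos_Reals_iff complex_eq_iff\<close>)+
  have cont: "continuous_on S G"
  proof -
    have "continuous_on S q" using q(1) holomorphic_on_imp_continuous_on continuous_on_subset by blast
    then show ?thesis
      unfolding G_def E_def
      by (intro continuous_intros)
         (use Z in \<open>force simp: S_def complex_nonpos_Reals_iff complex_eq_iff\<close>)+
  qed
  have clS: "closed S"
    unfolding S_def by (intro closed_Collect_conj closed_Collect_le) (auto intro!: continuous_intros)
  have "norm (G (of_real x)) \<le> C * exp (2 * \<sigma> / pi)"
  proof (rule maximum_modulus_frontier[of G S])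
    \<comment> \<open>An interior point can be moved left by \<open>e\<close> within
      \<open>S\<close>, which makes both weak inequalities strict.\<close>
    have "z \<in> {z. Re z > 0 \<and> Re (z\<^sup>2) > 0}" if "z \<in> interior S" for z
    proof -
      from that obtain e where e: "e > 0" "cball z e \<subseteq> S" by (auto simp: mem_interior_cball)
      have "z - of_real e \<in> S" using e by (intro subsetD[OF e(2)]) (auto simp: dist_norm)
      moreover have "z \<in> S" using e by (intro subsetD[OF e(2)]) auto
      ultimately have *: "Re z \<ge> e" "(Re z - e)\<^sup>2 \<ge> (Im z)\<^sup>2"
        by (auto simp: S_def power2_eq_square)
      have "(Re z - e)\<^sup>2 < (Re z)\<^sup>2" using * e by (intro power_strict_mono) auto
      then show ?thesis unfolding mem_Collect_eq Re_power2 using * e by linarith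
    qed
    then show "G holomorphic_on interior S" using opn holomorphic_on_subset by blast
    show "continuous_on (closure S) G" using cont clS by simp
    show "bounded S"
      by (rule bounded_subset[OF bounded_cball[of 0 "sqrt R"]]) (auto simp: S_def intro: real_le_rsqrt)
    show "of_real x \<in> S" using x by (auto simp: S_def)
    fix z assume "z \<in> frontier S"
    then have zS: "z \<in> S" and zi: "z \<notin> interior S" using clS by (auto simp: frontier_def)
    have zRe: "Re z \<ge> 0" "Re (z\<^sup>2) \<ge> 0" using zS by (auto simp: S_def)
    \<comment> \<open>The frontier lies on the two rays, where the Blaschke factors have modulus
      one, and on the arc, where \<open>blaschke_factor_lower\<close> applies.\<close>
    have "Re (z\<^sup>2) = 0 \<or> (cmod z)\<^sup>2 = R"
    proof (rule ccontr)
      assume *: "\<not> ?thesis"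
      then have "Re z \<noteq> 0" using zRe by (auto simp: Re_power2)
      then have "z \<in> {z. Re z > 0 \<and> Re (z\<^sup>2) > 0 \<and> (cmod z)\<^sup>2 < R}" (is "_ \<in> ?T")
        using * zS by (auto simp: S_def)
      moreover have "open ?T" by (intro open_Collect_conj open_Collect_less) (auto intro!: continuous_intros)
      moreover have "?T \<subseteq> S" by (auto simp: S_def)
      ultimately show False using zi interior_maximal by blast
    qed
    then have fac: "cmod (of_real (p\<^sup>2) + z\<^sup>2) \<le> cmod (of_real (p\<^sup>2) - z\<^sup>2) * exp (4 * p\<^sup>2 / R\<^sup>2 * Re (z\<^sup>2))"
      if "p \<in> Z" for p
    proof
      assume "(cmod z)\<^sup>2 = R"
      then show ?thesis
        using blaschke_factor_lower[of "z\<^sup>2" R "p\<^sup>2"] zRe R[OF that] Z(2)[OF that] by (auto simp: norm_power)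
    next
      assume *: "Re (z\<^sup>2) = 0"
      have "(cmod (of_real (p\<^sup>2) + z\<^sup>2))\<^sup>2 = (cmod (of_real (p\<^sup>2) - z\<^sup>2))\<^sup>2"
        unfolding cmod_power2 plus_complex.sel minus_complex.sel * by simp
      then show ?thesis using * by simp
    qed
    have "(\<Prod>p\<in>Z. cmod (of_real (p\<^sup>2) + z\<^sup>2)) \<le> (\<Prod>p\<in>Z. cmod (of_real (p\<^sup>2) - z\<^sup>2) * exp (4 * p\<^sup>2 / R\<^sup>2 * Re (z\<^sup>2)))"
      using fac by (intro prod_mono) auto
    also have "\<dots> = (\<Prod>p\<in>Z. cmod (of_real (p\<^sup>2) - z\<^sup>2)) * exp (\<kappa> * Re (z\<^sup>2))"
      using Z by (simp add: prod.distrib exp_sum \<kappa>_def sum_distrib_right)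
    finally have P: "(\<Prod>p\<in>Z. cmod (of_real (p\<^sup>2) + z\<^sup>2)) \<le> (\<Prod>p\<in>Z. cmod (of_real (p\<^sup>2) - z\<^sup>2)) * exp (\<kappa> * Re (z\<^sup>2))" .
    \<comment> \<open>A zero of \<open>p\<^sup>2 - z\<^sup>2\<close> on the frontier would by
      \<open>fac\<close> also be a zero of \<open>p\<^sup>2 + z\<^sup>2\<close>, whose real part is
      positive.\<close>
    have pos: "(\<Prod>p\<in>Z. cmod (of_real (p\<^sup>2) - z\<^sup>2)) > 0"
    proof (rule prod_pos)
      fix p assume p: "p \<in> Z"
      have "cmod (of_real (p\<^sup>2) - z\<^sup>2) \<noteq> 0"
      proof
        assume 0: "cmod (of_real (p\<^sup>2) - z\<^sup>2) = 0"
        then have "cmod (of_real (p\<^sup>2) + z\<^sup>2) = 0" using fac[OF p] by simp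
        then have "Re (of_real (p\<^sup>2) + z\<^sup>2) = 0" by simp
        then have "p\<^sup>2 + Re (z\<^sup>2) = 0" by simp
        then show False using zRe zero_less_power[OF Z(2)[OF p], of 2] by linarith
      qed
      then show "0 < cmod (of_real (p\<^sup>2) - z\<^sup>2)" by simp
    qed
    have "cmod (G z) * (\<Prod>p\<in>Z. cmod (of_real (p\<^sup>2) - z\<^sup>2))
        \<le> C * exp (2 * \<sigma> / pi) * exp (- \<kappa> * Re (z\<^sup>2)) * ((\<Prod>p\<in>Z. cmod (of_real (p\<^sup>2) - z\<^sup>2)) * exp (\<kappa> * Re (z\<^sup>2)))"
      unfolding GB[OF zRe(1)] using C
      by (intro mult_mono hE zS P) (auto intro!: prod_nonneg mult_nonneg_nonneg)
    also have "\<dots> = C * exp (2 * \<sigma> / pi) * (\<Prod>p\<in>Z. cmod (of_real (p\<^sup>2) - z\<^sup>2))"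
      by (simp add: exp_minus)
    finally show "norm (G z) \<le> C * exp (2 * \<sigma> / pi)" using pos by simp
  qed
  then have "cmod (G (of_real x)) * (\<Prod>p\<in>Z. cmod (of_real (p\<^sup>2) - (of_real x)\<^sup>2))
     \<le> C * exp (2 * \<sigma> / pi) * (\<Prod>p\<in>Z. cmod (of_real (p\<^sup>2) - (of_real x)\<^sup>2))"
    by (intro mult_right_mono) (auto intro: prod_nonneg)
  moreover have "cmod (of_real (p\<^sup>2) - (of_real x)\<^sup>2) = \<bar>p\<^sup>2 - x\<^sup>2\<bar>" "cmod (of_real (p\<^sup>2) + (of_real x)\<^sup>2) = p\<^sup>2 + x\<^sup>2" for p
    unfolding of_real_power[symmetric] of_real_diff[symmetric] of_real_add[symmetric] norm_of_real by auto
  ultimately have *: "cmod (h (of_real x)) * cmod (E (of_real x)) * (\<Prod>p\<in>Z. p\<^sup>2 + x\<^sup>2) \<le> C * exp (2 * \<sigma> / pi) * (\<Prod>p\<in>Z. \<bar>p\<^sup>2 - x\<^sup>2\<bar>)"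
    using GB[of "of_real x"] x by simp
  have pos: "(\<Prod>p\<in>Z. p\<^sup>2 + x\<^sup>2) > 0" using x by (intro prod_pos) (auto intro: add_nonneg_pos)
  have "E (of_real x) = of_real (exp (2 * \<sigma> / pi * (x\<^sup>2 * ln (1 + x\<^sup>2)) - k * x\<^sup>2))"
  proof -
    have "1 + (complex_of_real x)\<^sup>2 = of_real (1 + x\<^sup>2)" by simp
    then have "Ln (1 + (complex_of_real x)\<^sup>2) = of_real (ln (1 + x\<^sup>2))"
      using x by (metis Ln_of_real add_pos_nonneg zero_le_power2 zero_less_one)
    then show ?thesis unfolding E_def by (simp flip: exp_of_real)
  qed
  \<comment> \<open>The logarithmic factor is at least one here, since
    \<open>x\<^sup>2 * ln (1 + x\<^sup>2) \<ge> 0\<close>; removing \<open>E\<close> costs only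
    \<open>exp (k * x\<^sup>2)\<close>.\<close>
  then have "cmod (E (of_real x)) \<ge> exp (- k * x\<^sup>2)"
    using \<sigma> by simp
  then have "cmod (h (of_real x)) * exp (- k * x\<^sup>2) * (\<Prod>p\<in>Z. p\<^sup>2 + x\<^sup>2) \<le> cmod (h (of_real x)) * cmod (E (of_real x)) * (\<Prod>p\<in>Z. p\<^sup>2 + x\<^sup>2)"
    using pos by (intro mult_right_mono mult_left_mono) auto
  with * have "cmod (h (of_real x)) * exp (- k * x\<^sup>2) * (\<Prod>p\<in>Z. p\<^sup>2 + x\<^sup>2) \<le> C * exp (2 * \<sigma> / pi) * (\<Prod>p\<in>Z. \<bar>p\<^sup>2 - x\<^sup>2\<bar>)"
    by linarith
  then have "cmod (h (of_real x)) * (\<Prod>p\<in>Z. p\<^sup>2 + x\<^sup>2) \<le> C * (exp (2 * \<sigma> / pi) * exp (k * x\<^sup>2)) * (\<Prod>p\<in>Z. \<bar>p\<^sup>2 - x\<^sup>2\<bar>)"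
    by (simp add: field_simps exp_minus)
  then show ?thesis using pos
    unfolding exp_add prod_dividef by (simp add: pos_le_divide_eq)
qed

section \<open>Harmonic sums and the limit of many zeros\<close>

lemma ln_add_one_diff_le:
  fixes x :: real
  assumes "x > 0"
  shows "ln (x + 1) - ln x \<le> 1 / x"
proof -
  have "ln (x + 1) - ln x = ln (1 + 1 / x)"
    using assms ln_div[of "x + 1" x] by (simp add: field_simps)
  also have "\<dots> \<le> 1 / x" using assms by (intro ln_add_one_self_le_self) auto
  finally show ?thesis .
qed

lemma sum_inverse_ge_ln:
  fixes m n M :: nat
  assumes "m \<ge> 1" "m \<le> n"
  shows "ln (real n + 1 + real M) - ln (real m + real M) \<le> (\<Sum>i=m..n. 1 / real (i + M))"
  using assms(2)
proof (induction n rule: dec_induct)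
  case base
  show ?case using ln_add_one_diff_le[of "real m + real M"] assms(1) by (simp add: add_ac)
next
  case (step n)
  show ?case using step ln_add_one_diff_le[of "real n + 1 + real M"] by (simp add: add_ac)
qed

text \<open>Fix \<open>x\<close> and let the number of zeros in \<open>sector_zero_bound\<close>
  grow like \<open>n\<close>, with \<open>R\<close> proportional to \<open>n\<close>. The growth of
  \<open>h\<close> contributes a power of \<open>n\<close> with exponent
  \<open>A = 2 * \<sigma> / pi * x\<^sup>2\<close>; the Blaschke product contributes one with
  exponent \<open>- D\<close>, \<open>D = 2 / c * x\<^sup>2\<close>, because
  \<open>(lam i)\<^sup>2 \<le> c * i\<close> bounds its logarithm by a negative multiple of a
  harmonic sum. The hypothesis on \<open>a\<close> leaves room for some
  \<open>c < pi / \<sigma>\<close>, that is \<open>A < D\<close>, and the bound tends to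
  zero.\<close>

theorem entire_gaussian_zeros_imp_zero:
  fixes h :: "complex \<Rightarrow> complex" and C \<sigma> a :: real and lam :: "nat \<Rightarrow> real"
  assumes hol: "h holomorphic_on UNIV"
    and bd: "\<And>z. cmod (h z) \<le> C * exp (2 * \<sigma> * (Im z)\<^sup>2)"
    and \<sigma>: "\<sigma> > 0" and pos: "\<And>n. n \<ge> 1 \<Longrightarrow> lam n > 0" and mono: "strict_mono_on {1..} lam"
    and lim: "(\<lambda>n. lam n / sqrt (real n)) \<longlonglongrightarrow> a" and a: "a < sqrt (pi / \<sigma>)"
    and zero: "\<And>n. n \<ge> 1 \<Longrightarrow> h (of_real (lam n)) = 0"
  shows "h z = 0"
proof -
  have C: "C \<ge> 0" using order_trans[OF norm_ge_zero bd[of 0]] by simp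
  have a0: "a \<ge> 0"
    by (rule tendsto_lowerbound[OF lim]) (auto intro!: eventually_sequentiallyI[of 1] less_imp_le[OF pos] divide_nonneg_nonneg)
  then have "a\<^sup>2 < (sqrt (pi / \<sigma>))\<^sup>2" using a by (intro power_strict_mono) auto
  then have "a\<^sup>2 < pi / \<sigma>" using \<sigma> by simp
  then obtain c where c: "a\<^sup>2 < c" "c < pi / \<sigma>" using dense by blast
  have c0: "c > 0" using c(1) zero_le_power2[of a] by linarith
  have "(\<lambda>n. (lam n / sqrt (real n))\<^sup>2) \<longlonglongrightarrow> a\<^sup>2" by (intro tendsto_intros lim)
  then have "eventually (\<lambda>n. (lam n / sqrt (real n))\<^sup>2 < c) sequentially"
    using c(1) by (rule order_tendstoD)
  then obtain N0 where N0: "\<And>n. n \<ge> N0 \<Longrightarrow> (lam n / sqrt (real n))\<^sup>2 < c"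
    unfolding eventually_sequentially by blast
  define m where "m = max 1 N0"
  have m1: "m \<ge> 1" by (simp add: m_def)
  have lamc: "(lam n)\<^sup>2 \<le> c * real n" if "n \<ge> m" for n
    using N0[of n] that by (simp add: m_def power_divide field_simps)
  \<comment> \<open>Up to the first zero the numerators of the Blaschke factors need no absolute
    values; the identity theorem then passes from this interval to the plane.\<close>
  have hx: "h (of_real x) = 0" if x: "0 < x" "x \<le> lam 1" for x
  proof -
    have lamx: "x \<le> lam n" if "n \<ge> 1" for n
      using strict_mono_onD[OF mono, of 1 n] that x by (cases "n = 1") auto
    \<comment> \<open>Chosen such that \<open>x\<^sup>2 \<le> c * M\<close>: then
      \<open>(lam i)\<^sup>2 + x\<^sup>2 \<le> c * (i + M)\<close>, and the \<open>i\<close>-th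
      factor is at most \<open>exp (- D / (i + M))\<close>.\<close>
    define M where "M = nat \<lceil>x\<^sup>2 / c\<rceil>"
    have M: "x\<^sup>2 \<le> c * real M"
    proof -
      have "x\<^sup>2 / c \<le> real M" unfolding M_def by (rule real_nat_ceiling_ge)
      then show ?thesis using c0 by (simp add: field_simps)
    qed
    define A where "A = 2 * \<sigma> / pi * x\<^sup>2"
    define D where "D = 2 / c * x\<^sup>2"
    \<comment> \<open>The summand \<open>1 / (16 * c)\<close> bounds the arc loss: at most
      \<open>n\<close> terms, each at most \<open>1 / (2 * R)\<close>, with
      \<open>R = 8 * c * n\<close>.\<close>
    define K where "K = \<sigma> * (1 + 2 / pi) + 1 / (16 * c)"
    define B where "B n = C * exp (2 * \<sigma> / pi + K * x\<^sup>2 + D * ln (real m + real M) + A * ln (1 + 8 * c * real n) - D * ln (real n + 1 + real M))" for n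
    have AD: "0 < A" "A < D"
      using c c0 \<sigma> x unfolding A_def D_def by (auto simp: field_simps)
    have "cmod (h (of_real x)) \<le> B n" if n: "n \<ge> m" for n
    proof -
      define Z where "Z = lam ` {m..n}"
      define R where "R = 8 * (c * real n)"
      define k where "k = 2 * \<sigma> / pi * ln (1 + R) + \<sigma> * (1 + 2 / pi) + (\<Sum>p\<in>Z. 4 * p\<^sup>2 / R\<^sup>2)"
      have R0: "R > 0" using c0 n m1 by (simp add: R_def)
      have inj: "inj_on lam {m..n}"
        using mono m1 by (intro inj_on_subset[OF strict_mono_on_imp_inj_on[OF mono]]) auto
      have pZ: "8 * p\<^sup>2 \<le> R" if "p \<in> Z" for p
      proof -
        from that obtain i where i: "p = lam i" "m \<le> i" "i \<le> n" by (auto simp: Z_def)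
        have "p\<^sup>2 \<le> c * real i" using lamc i by simp
        also have "\<dots> \<le> c * real n" using i c0 by simp
        finally show ?thesis by (simp add: R_def)
      qed
      have "x\<^sup>2 \<le> (lam n)\<^sup>2" using x lamx[of n] n m1 by (intro power_mono) auto
      also have "\<dots> \<le> c * real n" using lamc n by simp
      also have "\<dots> \<le> R" using c0 by (simp add: R_def)
      finally have xR: "x\<^sup>2 \<le> R" .
      have "cmod (h (of_real x)) \<le> C * exp (2 * \<sigma> / pi + k * x\<^sup>2) * (\<Prod>p\<in>Z. \<bar>p\<^sup>2 - x\<^sup>2\<bar> / (p\<^sup>2 + x\<^sup>2))"
        using m1 by (intro sector_zero_bound[OF hol bd \<sigma> _ _ _ pZ x(1) xR k_def]) (auto simp: Z_def intro: pos zero)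
      also have "(\<Prod>p\<in>Z. \<bar>p\<^sup>2 - x\<^sup>2\<bar> / (p\<^sup>2 + x\<^sup>2)) \<le> exp (- D * (\<Sum>i=m..n. 1 / real (i + M)))"
      proof -
        have "(\<Prod>p\<in>Z. \<bar>p\<^sup>2 - x\<^sup>2\<bar> / (p\<^sup>2 + x\<^sup>2)) = (\<Prod>i=m..n. \<bar>(lam i)\<^sup>2 - x\<^sup>2\<bar> / ((lam i)\<^sup>2 + x\<^sup>2))"
          unfolding Z_def by (subst prod.reindex[OF inj]) simp
        also have "\<dots> \<le> (\<Prod>i=m..n. exp (- D * (1 / real (i + M))))"
        proof (intro prod_mono conjI)
          fix i assume i: "i \<in> {m..n}"
          have x2: "x\<^sup>2 > 0" using x by simp
          have l: "x\<^sup>2 \<le> (lam i)\<^sup>2" using x lamx[of i] i m1 by (intro power_mono) auto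
          have "\<bar>(lam i)\<^sup>2 - x\<^sup>2\<bar> / ((lam i)\<^sup>2 + x\<^sup>2) = 1 + (- (2 * x\<^sup>2 / ((lam i)\<^sup>2 + x\<^sup>2)))"
            using l x2 by (simp add: field_simps)
          also have "\<dots> \<le> exp (- (2 * x\<^sup>2 / ((lam i)\<^sup>2 + x\<^sup>2)))" by (rule exp_ge_add_one_self)
          also have "\<dots> \<le> exp (- (2 * x\<^sup>2 / (c * real (i + M))))"
          proof -
            have "(lam i)\<^sup>2 + x\<^sup>2 \<le> c * real (i + M)" using M lamc[of i] i by (simp add: distrib_left)
            then have "2 * x\<^sup>2 / (c * real (i + M)) \<le> 2 * x\<^sup>2 / ((lam i)\<^sup>2 + x\<^sup>2)"
              using l x2 by (intro frac_le) (auto intro: add_nonneg_pos)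
            then show ?thesis by simp
          qed
          also have "\<dots> = exp (- D * (1 / real (i + M)))" by (simp add: D_def)
          finally show "\<bar>(lam i)\<^sup>2 - x\<^sup>2\<bar> / ((lam i)\<^sup>2 + x\<^sup>2) \<le> exp (- D * (1 / real (i + M)))" .
        qed (auto intro!: divide_nonneg_nonneg)
        also have "\<dots> = exp (- D * (\<Sum>i=m..n. 1 / real (i + M)))"
          by (subst exp_sum[symmetric]) (auto simp: sum_distrib_left)
        finally show ?thesis .
      qed
      also have "C * exp (2 * \<sigma> / pi + k * x\<^sup>2) * exp (- D * (\<Sum>i=m..n. 1 / real (i + M)))
        = C * exp (2 * \<sigma> / pi + k * x\<^sup>2 - D * (\<Sum>i=m..n. 1 / real (i + M)))"
        unfolding mult.assoc exp_add[symmetric] by simp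
      also have "\<dots> \<le> B n"
        unfolding B_def
      proof (intro mult_left_mono C, subst exp_le_cancel_iff)
        have "(\<Sum>p\<in>Z. 4 * p\<^sup>2 / R\<^sup>2) \<le> (\<Sum>p\<in>Z. 1 / (2 * R))"
          using pZ R0 by (intro sum_mono) (auto simp: field_simps power2_eq_square)
        also have "\<dots> = real (card {m..n}) / (2 * R)" unfolding Z_def using card_image[OF inj] by simp
        also have "\<dots> \<le> real n / (2 * R)" using R0 m1 by (intro divide_right_mono) auto
        also have "\<dots> = 1 / (16 * c)" using c0 n m1 by (simp add: R_def)
        finally have "k \<le> 2 * \<sigma> / pi * ln (1 + R) + K" by (simp add: k_def K_def)
        then have "k * x\<^sup>2 \<le> (2 * \<sigma> / pi * ln (1 + R) + K) * x\<^sup>2" by (intro mult_right_mono) auto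
        moreover have "\<dots> = A * ln (1 + 8 * c * real n) + K * x\<^sup>2" by (simp add: A_def R_def algebra_simps)
        moreover have "D * (ln (real n + 1 + real M) - ln (real m + real M)) \<le> D * (\<Sum>i=m..n. 1 / real (i + M))"
          using AD by (intro mult_left_mono sum_inverse_ge_ln m1 n) auto
        ultimately show "2 * \<sigma> / pi + k * x\<^sup>2 - D * (\<Sum>i=m..n. 1 / real (i + M))
          \<le> 2 * \<sigma> / pi + K * x\<^sup>2 + D * ln (real m + real M) + A * ln (1 + 8 * c * real n) - D * ln (real n + 1 + real M)"
          by (simp add: algebra_simps)
      qed
      finally show ?thesis using C by (simp add: mult_left_mono)
    qed
    moreover have "B \<longlonglongrightarrow> 0"
      using AD c0 unfolding B_def by real_asymp
    ultimately have "cmod (h (of_real x)) \<le> 0"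
      by (intro tendsto_lowerbound[of B]) (auto intro: eventually_sequentiallyI[of m])
    then show ?thesis by simp
  qed
  show ?thesis
    by (rule holomorphic_zero_near_0[OF hol pos[of 1]]) (use hx in auto)
qed

section \<open>Injectivity of the Fourier transform\<close>

lemma borel_measurable_cnj[measurable (raw)]:
  "f \<in> borel_measurable M \<Longrightarrow> (\<lambda>x. cnj (f x)) \<in> borel_measurable M"
  by (rule measurable_compose[OF _ borel_measurable_continuous_onI]) (auto intro: continuous_intros)

text \<open>The positive and the negative part of \<open>\<psi>\<close> have the same mass (take
  \<open>s = 0\<close>). If it is positive, both are normalised to probability densities and pushed
  forward along \<open>X\<close>; the hypothesis then says that the two laws have the same
  characteristic function, and Levy uniqueness identifies them.\<close>

lemma real_marginal_zero:
  fixes \<psi> X :: "'a \<Rightarrow> real"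
  assumes \<psi>: "integrable M \<psi>" and X[measurable]: "X \<in> borel_measurable M"
    and zero: "\<And>s. (LINT x|M. of_real (\<psi> x) * iexp (s * X x)) = 0"
    and A: "A \<in> sets borel"
  shows "(LINT x|M. \<psi> x * indicator A (X x)) = 0"
proof -
  note [measurable] = borel_measurable_integrable[OF \<psi>] A
  define p where "p e x = max 0 (e * \<psi> x)" for e x
  have p_meas[measurable]: "p e \<in> borel_measurable M" for e unfolding p_def by measurable
  have p_nonneg: "p e x \<ge> 0" for e x by (simp add: p_def)
  have p_int: "integrable M (p e)" for e unfolding p_def by (intro integrable_max integrable_mult_right \<psi>) auto
  have p_diff: "\<psi> x = p 1 x - p (- 1) x" for x by (auto simp: p_def max_def)
  have int_iexp: "integrable M (\<lambda>x. of_real (p e x) * iexp (s * X x))" for e s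
    by (rule Bochner_Integration.integrable_bound[OF p_int[of e]]) (auto simp: norm_mult)
  have int_ind: "integrable M (\<lambda>x. p e x * indicator A (X x))" for e
    by (rule Bochner_Integration.integrable_bound[OF p_int[of e]]) (auto simp: indicator_def p_nonneg)
  define m where "m = (LINT x|M. p 1 x)"
  have eq: "(LINT x|M. of_real (p 1 x) * iexp (s * X x)) = (LINT x|M. of_real (p (- 1) x) * iexp (s * X x))" for s
  proof -
    have "(LINT x|M. of_real (p 1 x) * iexp (s * X x)) - (LINT x|M. of_real (p (- 1) x) * iexp (s * X x))
        = (LINT x|M. of_real (p 1 x) * iexp (s * X x) - of_real (p (- 1) x) * iexp (s * X x))"
      by (rule Bochner_Integration.integral_diff[symmetric] int_iexp)+
    also have "\<dots> = (LINT x|M. of_real (\<psi> x) * iexp (s * X x))"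
      by (intro Bochner_Integration.integral_cong) (auto simp: p_diff algebra_simps)
    finally show ?thesis using zero[of s] by simp
  qed
  have m: "(LINT x|M. p e x) = m" if "e = 1 \<or> e = - 1" for e
    using eq[of 0] that p_int by (auto simp: m_def)
  have m0: "m \<ge> 0" unfolding m_def by (intro integral_nonneg_AE) (auto simp: p_nonneg)
  have "(LINT x|M. p 1 x * indicator A (X x)) = (LINT x|M. p (- 1) x * indicator A (X x))"
  proof (cases "m = 0")
    case True
    have "AE x in M. p e x = 0" if "e = 1 \<or> e = - 1" for e
      using integral_nonneg_eq_0_iff_AE[OF p_int[of e]] m[OF that] True p_nonneg by auto
    from this[of 1] this[of "- 1"] show ?thesis by (intro integral_cong_AE) auto
  next
    case False
    then have mpos: "m > 0" using m0 by simp
    define D where "D e = distr (density M (\<lambda>x. ennreal (p e x / m))) borel X" for e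
    have rd: "real_distribution (D e)" if "e = 1 \<or> e = - 1" for e
    proof -
      have "prob_space (density M (\<lambda>x. ennreal (p e x / m)))"
      proof
        have "emeasure (density M (\<lambda>x. ennreal (p e x / m))) (space (density M (\<lambda>x. ennreal (p e x / m))))
          = (\<integral>\<^sup>+ x. ennreal (p e x / m) \<partial>M)"
          by (simp add: emeasure_density cong: nn_integral_cong)
        also have "\<dots> = ennreal (LINT x|M. p e x / m)"
          using mpos p_int p_nonneg by (intro nn_integral_eq_integral) auto
        also have "\<dots> = 1" using m[OF that] mpos by simp
        finally show "emeasure (density M (\<lambda>x. ennreal (p e x / m))) (space (density M (\<lambda>x. ennreal (p e x / m)))) = 1" .
      qed
      then show ?thesis unfolding D_def by (intro prob_space.real_distribution_distr) auto
    qed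
    have int_D: "(LINT y|D e. f y) = (LINT x|M. p e x *\<^sub>R f (X x)) /\<^sub>R m"
      if [measurable]: "f \<in> borel_measurable borel" for f :: "real \<Rightarrow> 'b::{banach, second_countable_topology}" and e
      unfolding D_def using mpos p_nonneg
      by (simp add: integral_distr integral_density divide_inverse mult.commute
          flip: scaleR_scaleR)
    have "char (D 1) = char (D (- 1))"
    proof
      fix s
      show "char (D 1) s = char (D (- 1)) s"
        unfolding char_def using eq[of s] by (subst (1 2) int_D) (auto simp: scaleR_conv_of_real)
    qed
    then have "D 1 = D (- 1)" by (intro Levy_uniqueness rd) auto
    then have "(LINT y|D 1. indicator A y :: real) = (LINT y|D (- 1). indicator A y)" by simp
    then show ?thesis using mpos by (subst (asm) (1 2) int_D) auto
  qed
  then show ?thesis unfolding p_diff left_diff_distrib using int_ind by simp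
qed

text \<open>Conjugating the hypothesis at \<open>- s\<close> shows that it also holds for
  \<open>cnj \<psi>\<close>, hence for the real and the imaginary part.\<close>

lemma complex_marginal_zero:
  fixes \<psi> :: "'a \<Rightarrow> complex" and X :: "'a \<Rightarrow> real"
  assumes \<psi>: "integrable M \<psi>" and X[measurable]: "X \<in> borel_measurable M"
    and zero: "\<And>s. (LINT x|M. \<psi> x * iexp (s * X x)) = 0"
    and A: "A \<in> sets borel"
  shows "(LINT x|M. \<psi> x * indicator A (X x)) = 0"
proof -
  note [measurable] = borel_measurable_integrable[OF \<psi>] A
  have i: "integrable M (\<lambda>x. \<psi> x * iexp (s * X x))" "integrable M (\<lambda>x. cnj (\<psi> x) * iexp (s * X x))" for s
    by (rule Bochner_Integration.integrable_bound[OF integrable_norm[OF \<psi>]]; simp add: norm_mult)+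
  have zero': "(LINT x|M. cnj (\<psi> x) * iexp (s * X x)) = 0" for s
  proof -
    have "(LINT x|M. cnj (\<psi> x) * iexp (s * X x)) = (LINT x|M. cnj (\<psi> x * iexp (- s * X x)))"
      by (intro Bochner_Integration.integral_cong) (auto simp: exp_cnj)
    also have "\<dots> = cnj (LINT x|M. \<psi> x * iexp (- s * X x))" by (rule Bochner_Integration.integral_cnj)
    also have "\<dots> = 0" using zero[of "- s"] by simp
    finally show ?thesis .
  qed
  have "(LINT x|M. of_real (Re (\<psi> x)) * iexp (s * X x)) = 0" for s
  proof -
    have Re_eq: "of_real (Re z) = (z + cnj z) / 2" for z by (simp add: complex_add_cnj)
    have "(LINT x|M. of_real (Re (\<psi> x)) * iexp (s * X x)) = (LINT x|M. (\<psi> x * iexp (s * X x) + cnj (\<psi> x) * iexp (s * X x)) / 2)"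
      by (intro Bochner_Integration.integral_cong) (simp_all add: Re_eq algebra_simps add_divide_distrib)
    then show ?thesis using i zero zero' by simp
  qed
  then have re: "(LINT x|M. Re (\<psi> x) * indicator A (X x)) = 0"
    by (intro real_marginal_zero X A integrable_Re \<psi>) auto
  have "(LINT x|M. of_real (Im (\<psi> x)) * iexp (s * X x)) = 0" for s
  proof -
    have Im_eq: "of_real (Im z) = (z - cnj z) / (2 * \<i>)" for z by (simp add: complex_diff_cnj complex_eq_iff)
    have "(LINT x|M. of_real (Im (\<psi> x)) * iexp (s * X x)) = (LINT x|M. (\<psi> x * iexp (s * X x) - cnj (\<psi> x) * iexp (s * X x)) / (2 * \<i>))"
      by (intro Bochner_Integration.integral_cong) (simp_all add: Im_eq algebra_simps diff_divide_distrib)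
    then show ?thesis using i zero zero' by simp
  qed
  then have im: "(LINT x|M. Im (\<psi> x) * indicator A (X x)) = 0"
    by (intro real_marginal_zero X A integrable_Im \<psi>) auto
  have int: "integrable M (\<lambda>x. \<psi> x * indicator A (X x))"
    by (rule Bochner_Integration.integrable_bound[OF integrable_norm[OF \<psi>]]) (auto simp: indicator_def)
  have "Re (\<psi> x * indicator A (X x)) = Re (\<psi> x) * indicator A (X x)" "Im (\<psi> x * indicator A (X x)) = Im (\<psi> x) * indicator A (X x)" for x
    by (auto simp: indicator_def)
  then show ?thesis
    using re im integral_Re[OF int] integral_Im[OF int] by (simp add: complex_eq_iff)
qed

text \<open>One coordinate is cut off at a time. The frequency \<open>w\<close> stays free in the
  induction because the frequencies \<open>w + s *\<^sub>R b\<close> supply the whole characteristic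
  function, along \<open>b\<close>, of the function that is already cut off and modulated by
  \<open>w\<close>.\<close>

lemma fourier_zero_imp_box_zero:
  fixes \<phi> :: "'a::euclidean_space \<Rightarrow> complex"
  assumes \<phi>: "integrable lborel \<phi>"
    and zero: "\<And>w. (LINT x|lborel. \<phi> x * iexp (x \<bullet> w)) = 0"
    and B: "finite B" "B \<subseteq> Basis" and A: "\<And>b. A b \<in> sets borel"
  shows "(LINT x|lborel. \<phi> x * (\<Prod>b\<in>B. indicator (A b) (x \<bullet> b)) * iexp (x \<bullet> w)) = 0"
  using B
proof (induction B arbitrary: w rule: finite_induct)
  case empty
  then show ?case using zero by simp
next
  case (insert b B)
  note [measurable] = borel_measurable_integrable[OF \<phi>] A
  define \<psi> where "\<psi> x = \<phi> x * (\<Prod>b\<in>B. indicator (A b) (x \<bullet> b)) * iexp (x \<bullet> w)" for x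
  have "integrable lborel \<psi>"
  proof (rule Bochner_Integration.integrable_bound[OF integrable_norm[OF \<phi>]])
    show "\<psi> \<in> borel_measurable lborel" unfolding \<psi>_def by measurable
    show "AE x in lborel. cmod (\<psi> x) \<le> norm (cmod (\<phi> x))"
      by (auto simp: \<psi>_def norm_mult prod_norm[symmetric] indicator_def intro!: mult_left_le prod_le_1)
  qed
  moreover have "(LINT x|lborel. \<psi> x * iexp (s * (x \<bullet> b))) = 0" for s
  proof -
    have "(LINT x|lborel. \<psi> x * iexp (s * (x \<bullet> b)))
      = (LINT x|lborel. \<phi> x * (\<Prod>b\<in>B. indicator (A b) (x \<bullet> b)) * iexp (x \<bullet> (w + s *\<^sub>R b)))"
      by (intro Bochner_Integration.integral_cong)
         (auto simp: \<psi>_def inner_add_right exp_add[symmetric] distrib_left mult.assoc)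
    also have "\<dots> = 0" using insert by auto
    finally show ?thesis .
  qed
  ultimately have "(LINT x|lborel. \<psi> x * indicator (A b) (x \<bullet> b)) = 0"
    by (intro complex_marginal_zero A) auto
  moreover have "\<psi> x * indicator (A b) (x \<bullet> b) = \<phi> x * (\<Prod>b\<in>insert b B. indicator (A b) (x \<bullet> b)) * iexp (x \<bullet> w)" for x
    using insert by (simp add: \<psi>_def)
  ultimately show ?case by simp
qed

text \<open>The positive and the negative part are densities of two measures that agree on boxes, an
  intersection-stable generator; so the measures agree, and densities are unique almost
  everywhere.\<close>

lemma box_integrals_zero_imp_AE_zero:
  fixes \<psi> :: "'a::euclidean_space \<Rightarrow> real"
  assumes \<psi>: "integrable lborel \<psi>"
    and zero: "\<And>a b. (LINT x|lborel. \<psi> x * indicator (box a b) x) = 0"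
  shows "AE x in lborel. \<psi> x = 0"
proof -
  note [measurable] = borel_measurable_integrable[OF \<psi>]
  define p where "p e x = max 0 (e * \<psi> x)" for e x
  have p_meas[measurable]: "p e \<in> borel_measurable borel" for e unfolding p_def by measurable
  have p_nonneg: "p e x \<ge> 0" for e x by (simp add: p_def)
  have p_int: "integrable lborel (p e)" for e unfolding p_def by (intro integrable_max integrable_mult_right \<psi>) auto
  have p_diff: "\<psi> x = p 1 x - p (- 1) x" for x by (auto simp: p_def max_def)
  have int_ind: "integrable lborel (\<lambda>x. p e x * indicator (box a b) x)" for e a b
    by (rule Bochner_Integration.integrable_bound[OF p_int[of e]]) (auto simp: indicator_def p_nonneg)
  have em: "emeasure (density lborel (p e)) (box a b) = ennreal (LINT x|lborel. p e x * indicator (box a b) x)" for e a b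
    using int_ind p_nonneg
    by (subst nn_integral_eq_integral[symmetric]) (auto simp: emeasure_density ennreal_mult' simp flip: ennreal_indicator)
  have "density lborel (p 1) = density lborel (p (- 1))"
  proof (rule measure_eqI_generator_eq)
    let ?E = "range (\<lambda>(a, b). box a b::'a set)"
    show "Int_stable ?E" by (auto simp: Int_stable_def box_Int_box)
    show "?E \<subseteq> Pow UNIV" "sets (density lborel (p 1)) = sigma_sets UNIV ?E" "sets (density lborel (p (- 1))) = sigma_sets UNIV ?E"
      by (simp_all add: borel_eq_box)
    let ?A = "\<lambda>n::nat. box (- (real n *\<^sub>R One)) (real n *\<^sub>R One) :: 'a set"
    show "range ?A \<subseteq> ?E" "(\<Union>i. ?A i) = UNIV" unfolding UN_box_eq_UNIV by auto
    show "emeasure (density lborel (p 1)) (?A i) \<noteq> \<infinity>" for i unfolding em by simp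
    fix X assume "X \<in> ?E"
    then obtain a b where X: "X = box a b" by auto
    have "(LINT x|lborel. p 1 x * indicator (box a b) x) - (LINT x|lborel. p (- 1) x * indicator (box a b) x) = 0"
      using zero[of a b] int_ind unfolding p_diff left_diff_distrib by simp
    then show "emeasure (density lborel (p 1)) X = emeasure (density lborel (p (- 1))) X"
      unfolding X em by simp
  qed
  then have "AE x in lborel. ennreal (p 1 x) = ennreal (p (- 1) x)"
    using p_int by (subst (asm) sigma_finite_measure.density_unique_iff[OF sigma_finite_lborel]) auto
  then show ?thesis
    by eventually_elim (use p_diff p_nonneg in auto)
qed

theorem fourier_zero_imp_AE_zero:
  fixes \<phi> :: "'a::euclidean_space \<Rightarrow> complex"
  assumes \<phi>: "integrable lborel \<phi>"
    and zero: "\<And>w. (LINT x|lborel. \<phi> x * iexp (x \<bullet> w)) = 0"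
  shows "AE x in lborel. \<phi> x = 0"
proof -
  note [measurable] = borel_measurable_integrable[OF \<phi>]
  have box: "(LINT x|lborel. \<phi> x * indicator (box a b) x) = 0" for a b
  proof -
    have "indicator (box a b) x = (\<Prod>i\<in>Basis. indicator {a \<bullet> i<..<b \<bullet> i} (x \<bullet> i) :: complex)" for x
      by (auto simp: indicator_def mem_box)
    then show ?thesis
      using fourier_zero_imp_box_zero[OF \<phi> zero, of Basis "\<lambda>i. {a \<bullet> i<..<b \<bullet> i}" 0] by simp
  qed
  have int: "integrable lborel (\<lambda>x. \<phi> x * indicator (box a b) x)" for a b
    by (rule Bochner_Integration.integrable_bound[OF integrable_norm[OF \<phi>]]) (auto simp: indicator_def)
  have ReIm: "Re (\<phi> x * indicator (box a b) x) = Re (\<phi> x) * indicator (box a b) x"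
    "Im (\<phi> x * indicator (box a b) x) = Im (\<phi> x) * indicator (box a b) x" for x a b
    by (auto simp: indicator_def)
  have "AE x in lborel. Re (\<phi> x) = 0"
    using integral_Re[OF int] box unfolding ReIm by (intro box_integrals_zero_imp_AE_zero integrable_Re \<phi>) auto
  moreover have "AE x in lborel. Im (\<phi> x) = 0"
    using integral_Im[OF int] box unfolding ReIm by (intro box_integrals_zero_imp_AE_zero integrable_Im \<phi>) auto
  ultimately show ?thesis by eventually_elim (simp add: complex_eq_iff)
qed

section \<open>Recovering a function from the modulus of its transform\<close>

lemma mult_le_sum_squares:
  fixes a b :: real
  shows "a * b \<le> a\<^sup>2 + b\<^sup>2"
proof -
  have "2 * (a * b) \<le> a\<^sup>2 + b\<^sup>2" using sum_squares_bound[of a b] by simp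
  moreover have "0 \<le> a\<^sup>2 + b\<^sup>2" by simp
  ultimately show ?thesis by linarith
qed

lemma lborel_integrable_translate:
  fixes f :: "'a::euclidean_space \<Rightarrow> 'b::{banach, second_countable_topology}"
  assumes "integrable lborel f"
  shows "integrable lborel (\<lambda>x. f (c + x))" "integrable lborel (\<lambda>x. f (x + c))" "integrable lborel (\<lambda>x. f (x - c))"
proof -
  have *: "integrable lborel (\<lambda>x. f (c + x))" for c
    using assms by (subst (asm) lborel_distr_plus[of c, symmetric], subst (asm) integrable_distr_eq) auto
  show "integrable lborel (\<lambda>x. f (c + x))" "integrable lborel (\<lambda>x. f (x + c))" "integrable lborel (\<lambda>x. f (x - c))"
    using *[of c] *[of "- c"] by (auto simp: add.commute)
qed

lemma lborel_integral_translate: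
  fixes f :: "'a::euclidean_space \<Rightarrow> 'b::{banach, second_countable_topology}"
  assumes [measurable]: "f \<in> borel_measurable borel"
  shows "(LINT x|lborel. f (c + x)) = (LINT x|lborel. f x)"
  by (subst (2) lborel_distr_plus[of c, symmetric], subst integral_distr) auto

lemma lborel_AE_translate:
  fixes c :: "'a::euclidean_space"
  assumes [measurable]: "Measurable.pred borel P" and "AE x in lborel. P (c + x)"
  shows "AE x in lborel. P x"
  by (subst lborel_distr_plus[of c, symmetric], subst AE_distr_iff) (use assms in auto)

lemma integrable_mult_L2:
  fixes f g :: "'a \<Rightarrow> complex"
  assumes [measurable]: "f \<in> borel_measurable M" "g \<in> borel_measurable M"
    and "integrable M (\<lambda>x. (cmod (f x))\<^sup>2)" "integrable M (\<lambda>x. (cmod (g x))\<^sup>2)"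
  shows "integrable M (\<lambda>x. f x * g x)"
proof (rule Bochner_Integration.integrable_bound[OF Bochner_Integration.integrable_add[OF assms(3,4)]])
  show "AE x in M. norm (f x * g x) \<le> norm ((cmod (f x))\<^sup>2 + (cmod (g x))\<^sup>2)"
    by (auto simp: norm_mult mult_le_sum_squares)
qed measurable

section \<open>Fourier transforms of correlations\<close>

lemma continuous_fourier:
  fixes \<phi> :: "'a::euclidean_space \<Rightarrow> complex"
  assumes \<phi>: "integrable lborel \<phi>"
  shows "continuous_on UNIV (\<lambda>w. LINT x|lborel. \<phi> x * iexp (x \<bullet> w))"
  unfolding continuous_on_sequentially o_def
proof safe
  fix u :: "nat \<Rightarrow> 'a" and a
  assume u: "u \<longlonglongrightarrow> a"
  note [measurable] = borel_measurable_integrable[OF \<phi>]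
  show "(\<lambda>n. LINT x|lborel. \<phi> x * iexp (x \<bullet> u n)) \<longlonglongrightarrow> (LINT x|lborel. \<phi> x * iexp (x \<bullet> a))"
    by (rule integral_dominated_convergence[OF _ _ integrable_norm[OF \<phi>]])
       (auto simp: norm_mult intro!: tendsto_intros u)
qed

text \<open>Integrating the modulus over \<open>s\<close> first, translation invariance leaves
  \<open>norm (\<gamma> y)\<close> times a constant, which is integrable in
  \<open>y\<close>.\<close>

lemma integrable_correlation:
  fixes \<phi> \<gamma> :: "'a::euclidean_space \<Rightarrow> complex"
  assumes \<phi>: "integrable lborel \<phi>" and \<gamma>: "integrable lborel \<gamma>"
  shows "integrable (lborel \<Otimes>\<^sub>M lborel) (\<lambda>(y, s). \<phi> (y + s) * \<gamma> y * iexp (s \<bullet> w))"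
proof -
  note [measurable] = borel_measurable_integrable[OF \<phi>] borel_measurable_integrable[OF \<gamma>]
  show ?thesis
  proof (rule lborel_pair.Fubini_integrable)
    have "(LINT s|lborel. norm (\<phi> (y + s) * \<gamma> y * iexp (s \<bullet> w))) = norm (\<gamma> y) * (LINT s|lborel. norm (\<phi> s))" for y
      using lborel_integral_translate[of "\<lambda>x. norm (\<phi> x)" y] by (simp add: norm_mult)
    then show "integrable lborel (\<lambda>y. LINT s|lborel. norm (case (y, s) of (y, s) \<Rightarrow> \<phi> (y + s) * \<gamma> y * iexp (s \<bullet> w)))"
      using \<gamma> by simp
    have "integrable lborel (\<lambda>s. \<phi> (y + s) * \<gamma> y * iexp (s \<bullet> w))" for y
      by (rule Bochner_Integration.integrable_bound[of _ "\<lambda>s. cmod (\<phi> (y + s)) * cmod (\<gamma> y)"])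
         (auto simp: norm_mult intro!: integrable_mult_left integrable_norm lborel_integrable_translate \<phi>)
    then show "AE y in lborel. integrable lborel (\<lambda>s. case (y, s) of (y, s) \<Rightarrow> \<phi> (y + s) * \<gamma> y * iexp (s \<bullet> w))"
      by simp
  qed measurable
qed

text \<open>The second identity is used twice: with \<open>\<gamma> = cnj \<phi>\<close>, where the
  right-hand side is a squared modulus, and later in the time shift \<open>t\<close>, for two
  different factors.\<close>

lemma
  fixes \<phi> \<gamma> :: "'a::euclidean_space \<Rightarrow> complex"
  assumes \<phi>: "integrable lborel \<phi>" and \<gamma>: "integrable lborel \<gamma>"
  shows integrable_correlation_integral: "integrable lborel (\<lambda>s. LINT y|lborel. \<phi> (y + s) * \<gamma> y)"
    and fourier_correlation: "(LINT s|lborel. (LINT y|lborel. \<phi> (y + s) * \<gamma> y) * iexp (s \<bullet> w))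
      = (LINT x|lborel. \<phi> x * iexp (x \<bullet> w)) * (LINT y|lborel. \<gamma> y * iexp (- (y \<bullet> w)))"
proof -
  note [measurable] = borel_measurable_integrable[OF \<phi>] borel_measurable_integrable[OF \<gamma>]
  show "integrable lborel (\<lambda>s. LINT y|lborel. \<phi> (y + s) * \<gamma> y)"
    using lborel_pair.integrable_snd[OF integrable_correlation[OF \<phi> \<gamma>, of 0]] by simp
  have "(LINT s|lborel. (LINT y|lborel. \<phi> (y + s) * \<gamma> y) * iexp (s \<bullet> w))
    = (LINT s|lborel. (LINT y|lborel. \<phi> (y + s) * \<gamma> y * iexp (s \<bullet> w)))"
    by simp
  also have "\<dots> = (LINT y|lborel. (LINT s|lborel. \<phi> (y + s) * \<gamma> y * iexp (s \<bullet> w)))"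
    by (rule lborel_pair.Fubini_integral[OF integrable_correlation[OF \<phi> \<gamma>]])
  also have "\<dots> = (LINT y|lborel. (LINT x|lborel. \<phi> x * iexp (x \<bullet> w)) * (\<gamma> y * iexp (- (y \<bullet> w))))"
  proof (intro Bochner_Integration.integral_cong refl)
    fix y
    have "(LINT x|lborel. \<phi> x * iexp (x \<bullet> w)) = (LINT s|lborel. \<phi> (y + s) * iexp ((y + s) \<bullet> w))"
      by (rule lborel_integral_translate[symmetric]) measurable
    also have "\<dots> = (LINT s|lborel. iexp (y \<bullet> w) * (\<phi> (y + s) * iexp (s \<bullet> w)))"
      by (intro Bochner_Integration.integral_cong) (auto simp: inner_add_left distrib_left exp_add)
    also have "\<dots> = iexp (y \<bullet> w) * (LINT s|lborel. \<phi> (y + s) * iexp (s \<bullet> w))" by simp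
    finally have "(LINT x|lborel. \<phi> x * iexp (x \<bullet> w)) * (\<gamma> y * iexp (- (y \<bullet> w)))
      = \<gamma> y * (LINT s|lborel. \<phi> (y + s) * iexp (s \<bullet> w))"
      by (simp add: exp_minus)
    also have "\<dots> = (LINT s|lborel. \<gamma> y * (\<phi> (y + s) * iexp (s \<bullet> w)))" by simp
    finally show "(LINT s|lborel. \<phi> (y + s) * \<gamma> y * iexp (s \<bullet> w)) = (LINT x|lborel. \<phi> x * iexp (x \<bullet> w)) * (\<gamma> y * iexp (- (y \<bullet> w)))"
      by (auto simp: mult_ac)
  qed
  also have "\<dots> = (LINT x|lborel. \<phi> x * iexp (x \<bullet> w)) * (LINT y|lborel. \<gamma> y * iexp (- (y \<bullet> w)))" by simp
  finally show "(LINT s|lborel. (LINT y|lborel. \<phi> (y + s) * \<gamma> y) * iexp (s \<bullet> w))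
      = (LINT x|lborel. \<phi> x * iexp (x \<bullet> w)) * (LINT y|lborel. \<gamma> y * iexp (- (y \<bullet> w)))" .
qed

lemma autocorrelation_eq:
  fixes \<phi>1 \<phi>2 :: "'a::euclidean_space \<Rightarrow> complex"
  assumes \<phi>: "integrable lborel \<phi>1" "integrable lborel \<phi>2"
    and eq: "\<And>w. cmod (LINT x|lborel. \<phi>1 x * iexp (x \<bullet> w)) = cmod (LINT x|lborel. \<phi>2 x * iexp (x \<bullet> w))"
  shows "AE s in lborel. (LINT y|lborel. \<phi>1 (y + s) * cnj (\<phi>1 y)) = (LINT y|lborel. \<phi>2 (y + s) * cnj (\<phi>2 y))"
proof -
  have cnj: "integrable lborel (\<lambda>y. cnj (\<phi>1 y))" "integrable lborel (\<lambda>y. cnj (\<phi>2 y))" using \<phi> by auto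
  have tr: "(LINT s|lborel. (LINT y|lborel. \<phi> (y + s) * cnj (\<phi> y)) * iexp (s \<bullet> w)) = of_real ((cmod (LINT x|lborel. \<phi> x * iexp (x \<bullet> w)))\<^sup>2)"
    if "integrable lborel \<phi>" for \<phi> w
  proof -
    have "(LINT y|lborel. cnj (\<phi> y) * iexp (- (y \<bullet> w))) = (LINT y|lborel. cnj (\<phi> y * iexp (y \<bullet> w)))"
      by (intro Bochner_Integration.integral_cong) (auto simp: exp_cnj)
    also have "\<dots> = cnj (LINT y|lborel. \<phi> y * iexp (y \<bullet> w))" by (rule Bochner_Integration.integral_cnj)
    finally show ?thesis
      using that by (subst fourier_correlation) (simp_all add: complex_norm_square del: Bochner_Integration.integral_cnj of_real_power)
  qed
  define K where "K \<phi> s = (LINT y|lborel. \<phi> (y + s) * cnj (\<phi> y))" for \<phi> :: "'a \<Rightarrow> complex" and s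
  have K: "integrable lborel (K \<phi>)" if "integrable lborel \<phi>" for \<phi>
    unfolding K_def using that by (intro integrable_correlation_integral) auto
  have Kw: "integrable lborel (\<lambda>s. K \<phi> s * iexp (s \<bullet> w))" if "integrable lborel \<phi>" for \<phi> w
    using borel_measurable_integrable[OF K[OF that]]
    by (intro Bochner_Integration.integrable_bound[OF integrable_norm[OF K[OF that]]]) (auto simp: norm_mult)
  have "AE s in lborel. K \<phi>1 s - K \<phi>2 s = 0"
  proof (rule fourier_zero_imp_AE_zero)
    show "integrable lborel (\<lambda>s. K \<phi>1 s - K \<phi>2 s)" using K \<phi> by auto
    show "(LINT s|lborel. (K \<phi>1 s - K \<phi>2 s) * iexp (s \<bullet> w)) = 0" for w
      using tr[OF \<phi>(1), of w] tr[OF \<phi>(2), of w] Kw \<phi> eq[of w] by (simp add: left_diff_distrib K_def)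
  qed
  then show ?thesis unfolding K_def by eventually_elim simp
qed

lemma AE_obtain_nonzero:
  assumes "AE x in M. P x" "\<not> (AE x in M. f x = 0)"
  obtains x where "P x" "f x \<noteq> 0"
proof -
  have "\<exists>x. P x \<and> f x \<noteq> 0"
  proof (rule ccontr)
    assume *: "\<not> ?thesis"
    from assms(1) have "AE x in M. f x = 0" by eventually_elim (use * in blast)
    with assms(2) show False by blast
  qed
  then show ?thesis using that by blast
qed

text \<open>Freezing \<open>y\<close> at a good point with \<open>f1 y \<noteq> 0\<close> exhibits
  \<open>f1\<close> as a multiple \<open>c * f2\<close>; substituting this back at two further good
  points forces \<open>c * cnj c = 1\<close>. If \<open>f1\<close> vanishes almost everywhere,
  freezing \<open>y\<close> with \<open>f2 y \<noteq> 0\<close> would make \<open>f2\<close> vanish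
  as well.\<close>

lemma rank_one_eq_imp_phase:
  fixes f1 f2 :: "'a::euclidean_space \<Rightarrow> complex"
  assumes eq: "AE y in lborel. AE x in lborel. f1 x * cnj (f1 y) = f2 x * cnj (f2 y)"
  shows "\<exists>c. cmod c = 1 \<and> (AE x in lborel. f1 x = c * f2 x)"
proof (cases "AE y in lborel. f1 y = 0")
  case True
  have "AE x in lborel. f1 x = 1 * f2 x"
  proof (cases "AE y in lborel. f2 y = 0")
    case True
    with \<open>AE y in lborel. f1 y = 0\<close> show ?thesis by eventually_elim simp
  next
    case False
    obtain y where y: "AE x in lborel. f1 x * cnj (f1 y) = f2 x * cnj (f2 y)" "f2 y \<noteq> 0"
      by (rule AE_obtain_nonzero[OF eq False])
    from y(1) True have "AE x in lborel. f2 x = 0" by eventually_elim (use y(2) in auto)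
    with False show ?thesis by simp
  qed
  then show ?thesis by (intro exI[of _ 1]) auto
next
  case False
  obtain y where y: "AE x in lborel. f1 x * cnj (f1 y) = f2 x * cnj (f2 y)" "f1 y \<noteq> 0"
    by (rule AE_obtain_nonzero[OF eq False])
  define c where "c = cnj (f2 y) / cnj (f1 y)"
  have c: "AE x in lborel. f1 x = c * f2 x"
    using y(1) by eventually_elim (use y(2) in \<open>auto simp: c_def field_simps\<close>)
  obtain z where z: "(AE x in lborel. f1 x * cnj (f1 z) = f2 x * cnj (f2 z)) \<and> f1 z = c * f2 z" "f1 z \<noteq> 0"
    by (rule AE_obtain_nonzero[OF AE_conjI[OF eq c] False])
  obtain x where x: "f1 x * cnj (f1 z) = f2 x * cnj (f2 z) \<and> f1 x = c * f2 x" "f1 x \<noteq> 0"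
    by (rule AE_obtain_nonzero[OF AE_conjI[OF conjunct1[OF z(1)] c] False])
  have "c * cnj c * (f2 x * cnj (f2 z)) = (c * f2 x) * cnj (c * f2 z)" by simp
  also have "\<dots> = f1 x * cnj (f1 z)" using x(1) z(1) by (simp only:)
  also have "\<dots> = f2 x * cnj (f2 z)" using x(1) by blast
  finally have "c * cnj c * (f2 x * cnj (f2 z)) = f2 x * cnj (f2 z)" .
  then have "c * cnj c = 1" using x z by auto
  then have "(cmod c)\<^sup>2 = 1" by (metis complex_norm_square of_real_eq_1_iff)
  then have "cmod c = 1" using power2_eq_imp_eq[of "cmod c" 1] by simp
  with c show ?thesis by blast
qed

text \<open>For a fixed shift \<open>s\<close>, the identity of autocorrelations says that the
  correlation \<open>K s\<close> of \<open>D s\<close> and \<open>G s\<close> vanishes in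
  \<open>t\<close>. Its transform factors into \<open>dh\<close> and the transform of
  \<open>G s\<close>. By \<open>nz\<close> the second factor is nonzero somewhere in every nonempty
  open set, so the continuous first factor has no room to be nonzero. Boundedness of
  \<open>\<gamma>\<close> makes the two halves of \<open>D s * G s\<close> separately
  integrable.\<close>

theorem STFT_modulus_determines_phase:
  fixes f1 f2 \<gamma> :: "'a::euclidean_space \<Rightarrow> complex"
  assumes meas[measurable]: "f1 \<in> borel_measurable borel" "f2 \<in> borel_measurable borel" "\<gamma> \<in> borel_measurable borel"
    and L2: "integrable lborel (\<lambda>x. (cmod (f1 x))\<^sup>2)" "integrable lborel (\<lambda>x. (cmod (f2 x))\<^sup>2)" "integrable lborel (\<lambda>x. (cmod (\<gamma> x))\<^sup>2)"
    and bdd: "\<And>x. cmod (\<gamma> x) \<le> B"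
    and eq: "\<And>t w. cmod (LINT x|lborel. f1 x * cnj (\<gamma> (x - t)) * iexp (x \<bullet> w)) = cmod (LINT x|lborel. f2 x * cnj (\<gamma> (x - t)) * iexp (x \<bullet> w))"
    and nz: "\<And>s U. open U \<Longrightarrow> U \<noteq> {} \<Longrightarrow> \<exists>w\<in>U. (LINT u|lborel. cnj (\<gamma> (u + s)) * \<gamma> u * iexp (- (u \<bullet> w))) \<noteq> 0"
  shows "\<exists>c. cmod c = 1 \<and> (AE x in lborel. f1 x = c * f2 x)"
proof -
  define D where "D s y = f1 (y + s) * cnj (f1 y) - f2 (y + s) * cnj (f2 y)" for s y
  define G where "G s u = cnj (\<gamma> (u + s)) * \<gamma> u" for s u
  define K where "K s t = (LINT u|lborel. D s (u + t) * G s u)" for s t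
  have auto_int: "integrable lborel (\<lambda>y. f (y + s) * cnj (f y))"
    if "f \<in> borel_measurable borel" "integrable lborel (\<lambda>x. (cmod (f x))\<^sup>2)" for f :: "'a \<Rightarrow> complex" and s
    using that lborel_integrable_translate(2)[OF that(2)] by (intro integrable_mult_L2) auto
  have D_int: "integrable lborel (D s)" for s
    unfolding D_def using L2 by (intro Bochner_Integration.integrable_diff auto_int) auto
  have G_int: "integrable lborel (G s)" for s
    unfolding G_def using L2(3) lborel_integrable_translate(2)[OF L2(3)] by (intro integrable_mult_L2) auto
  have G_bdd: "cmod (G s u) \<le> B * B" for s u
    unfolding G_def norm_mult by (intro mult_mono) (use bdd order_trans[OF norm_ge_zero bdd] in auto)
  have K0: "AE s in lborel. K s t = 0" for t
  proof -
    define \<phi> where "\<phi> f x = f x * cnj (\<gamma> (x - t))" for f :: "'a \<Rightarrow> complex" and x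
    have \<phi>_int: "integrable lborel (\<phi> f)" if "f \<in> borel_measurable borel" "integrable lborel (\<lambda>x. (cmod (f x))\<^sup>2)" for f
      unfolding \<phi>_def using that lborel_integrable_translate(3)[OF L2(3)] by (intro integrable_mult_L2) auto
    have "AE s in lborel. (LINT y|lborel. \<phi> f1 (y + s) * cnj (\<phi> f1 y)) = (LINT y|lborel. \<phi> f2 (y + s) * cnj (\<phi> f2 y))"
      by (intro autocorrelation_eq \<phi>_int meas L2) (auto simp: \<phi>_def eq)
    then show ?thesis
    proof eventually_elim
      fix s assume s: "(LINT y|lborel. \<phi> f1 (y + s) * cnj (\<phi> f1 y)) = (LINT y|lborel. \<phi> f2 (y + s) * cnj (\<phi> f2 y))"
      have eq: "\<phi> f (y + s) * cnj (\<phi> f y) = f (y + s) * cnj (f y) * G s (y - t)" for f y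
        by (simp add: \<phi>_def G_def algebra_simps)
      have int: "integrable lborel (\<lambda>y. f (y + s) * cnj (f y) * G s (y - t))"
        if [measurable]: "f \<in> borel_measurable borel" and "integrable lborel (\<lambda>x. (cmod (f x))\<^sup>2)" for f
      proof (rule Bochner_Integration.integrable_bound)
        show "integrable lborel (\<lambda>y. norm (f (y + s) * cnj (f y)) * (B * B))"
          by (rule integrable_mult_left, rule integrable_norm, rule auto_int[OF that])
        show "AE y in lborel. norm (f (y + s) * cnj (f y) * G s (y - t)) \<le> norm (norm (f (y + s) * cnj (f y)) * (B * B))"
        proof (rule AE_I2)
          fix y
          have "norm (f (y + s) * cnj (f y) * G s (y - t)) \<le> norm (f (y + s) * cnj (f y)) * (B * B)"
            unfolding norm_mult[of _ "G s _"] by (intro mult_left_mono G_bdd) auto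
          also have "\<dots> \<le> norm (norm (f (y + s) * cnj (f y)) * (B * B))"
            unfolding real_norm_def by (rule abs_ge_self)
          finally show "norm (f (y + s) * cnj (f y) * G s (y - t)) \<le> norm (norm (f (y + s) * cnj (f y)) * (B * B))" .
        qed
      qed (unfold G_def, measurable)
      have "K s t = (LINT y|lborel. D s y * G s (y - t))"
        using lborel_integral_translate[of "\<lambda>y. D s y * G s (y - t)" t] unfolding K_def
        by (simp add: add.commute D_def G_def)
      also have "\<dots> = 0"
        using s int[OF meas(1) L2(1)] int[OF meas(2) L2(2)] unfolding eq D_def left_diff_distrib by simp
      finally show "K s t = 0" .
    qed
  qed
  have [measurable]: "(\<lambda>x. K (snd x) (fst x)) \<in> borel_measurable (lborel \<Otimes>\<^sub>M lborel)"
    unfolding K_def D_def G_def by measurable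
  \<comment> \<open>Exchange of the quantifiers: for almost every fixed \<open>s\<close>, the
    function \<open>K s\<close> vanishes almost everywhere and can be transformed in
    \<open>t\<close>.\<close>
  have "{x \<in> space (lborel \<Otimes>\<^sub>M lborel). K (snd x) (fst x) = 0} \<in> sets (lborel \<Otimes>\<^sub>M lborel)"
    by measurable
  from lborel_pair.AE_commute[where P = "\<lambda>t s. K s t = 0", OF this] K0
  have "AE s in lborel. AE t in lborel. K s t = 0" by simp
  then have "AE s in lborel. AE y in lborel. D s y = 0"
  proof eventually_elim
    fix s assume s: "AE t in lborel. K s t = 0"
    define dh where "dh w = (LINT x|lborel. D s x * iexp (x \<bullet> w))" for w
    have prod0: "dh w * (LINT u|lborel. G s u * iexp (- (u \<bullet> w))) = 0" for w
    proof -
      have "(LINT t|lborel. K s t * iexp (t \<bullet> w)) = 0"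
        by (rule integral_eq_zero_AE) (use s in auto)
      then show ?thesis unfolding K_def using fourier_correlation[OF D_int[of s] G_int[of s], of w] by (simp add: dh_def)
    qed
    have "dh w = 0" for w
    proof (rule ccontr)
      assume w: "dh w \<noteq> 0"
      have "open {w. dh w \<noteq> 0}"
        unfolding dh_def by (intro open_Collect_neq continuous_fourier D_int continuous_on_const)
      then obtain v where "dh v \<noteq> 0" "(LINT u|lborel. G s u * iexp (- (u \<bullet> v))) \<noteq> 0"
        using nz[of "{w. dh w \<noteq> 0}" s] w by (auto simp: G_def)
      with prod0[of v] show False by simp
    qed
    then show "AE y in lborel. D s y = 0"
      by (intro fourier_zero_imp_AE_zero D_int) (auto simp: dh_def)
  qed
  moreover have "{x \<in> space (lborel \<Otimes>\<^sub>M lborel). D (fst x) (snd x) = 0} \<in> sets (lborel \<Otimes>\<^sub>M lborel)"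
    unfolding D_def by measurable
  ultimately have "AE y in lborel. AE s in lborel. D s y = 0"
    using lborel_pair.AE_commute[where P = "\<lambda>s y. D s y = 0"] by simp
  \<comment> \<open>With \<open>y\<close> fixed, the shift \<open>s\<close> becomes the point
    \<open>x = y + s\<close>; translations preserve null sets.\<close>
  then have "AE y in lborel. AE x in lborel. f1 x * cnj (f1 y) = f2 x * cnj (f2 y)"
  proof eventually_elim
    fix y assume D0: "AE s in lborel. D s y = 0"
    show "AE x in lborel. f1 x * cnj (f1 y) = f2 x * cnj (f2 y)"
      by (rule lborel_AE_translate[where c = y]) (use D0 in \<open>auto simp: D_def add.commute\<close>)
  qed
  then show ?thesis by (rule rank_one_eq_imp_phase)
qed

section \<open>Holomorphic parameter integrals and Gaussians\<close>

text \<open>Unit discs about points of \<open>ball z 1\<close> stay in \<open>cball z 2\<close>, so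
  Cauchy's inequality bounds the derivative by the same \<open>B\<close>. This supplies the majorant
  of difference quotients for the parameter integral.\<close>

lemma holomorphic_deriv_bound_unit:
  fixes f :: "complex \<Rightarrow> complex"
  assumes "f holomorphic_on UNIV" "\<And>w. w \<in> cball z 2 \<Longrightarrow> norm (f w) \<le> B" "w \<in> ball z 1"
  shows "norm (f w - f z) \<le> B * norm (w - z)"
proof (rule field_differentiable_bound[of "ball z 1" f "deriv f"])
  fix v assume v: "v \<in> ball z 1"
  show "(f has_field_derivative deriv f v) (at v within ball z 1)"
    by (rule holomorphic_derivI[OF assms(1) open_UNIV UNIV_I])
  have "norm ((deriv ^^ 1) f v) \<le> fact 1 * B / 1 ^ 1"
  proof (rule Cauchy_inequality)
    show "f holomorphic_on ball v 1" "continuous_on (cball v 1) f"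
      using assms(1) by (auto intro: holomorphic_on_subset holomorphic_on_imp_continuous_on)
    fix x assume x: "norm (v - x) = 1"
    have "dist z x \<le> dist z v + dist v x" by (rule dist_triangle)
    then have "x \<in> cball z 2" using v x by (simp add: dist_norm)
    then show "norm (f x) \<le> B" by (rule assms(2))
  qed auto
  then show "norm (deriv f v) \<le> B" by simp
qed (use assms(3) in auto)

text \<open>The majorant splits into a continuous function of \<open>z\<close> and an integrable one
  of \<open>x\<close>. The former is bounded on \<open>cball z 2\<close>, so one integrable function
  dominates all difference quotients with increments below 1.\<close>

lemma holomorphic_parameter_integral:
  fixes F :: "complex \<Rightarrow> 'a \<Rightarrow> complex" and N :: "complex \<Rightarrow> real" and B :: "'a \<Rightarrow> real"
  assumes meas[measurable]: "\<And>z. F z \<in> borel_measurable M"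
    and hol: "\<And>x. (\<lambda>z. F z x) holomorphic_on UNIV"
    and N: "continuous_on UNIV N" and B: "integrable M B"
    and bd: "\<And>z x. norm (F z x) \<le> N z * B x"
  shows "(\<lambda>z. LINT x|M. F z x) holomorphic_on UNIV"
proof -
  have int: "integrable M (F z)" for z
    by (rule Bochner_Integration.integrable_bound[OF integrable_mult_right[OF B, of "N z"]])
       (auto intro!: order_trans[OF bd abs_ge_self])
  have "\<exists>D. ((\<lambda>z. LINT x|M. F z x) has_field_derivative D) (at z)" for z
  proof -
    have "compact (N ` cball z 2)" using N by (intro compact_continuous_image continuous_on_subset[OF N]) auto
    then have "bounded (N ` cball z 2)" by (rule compact_imp_bounded)
    then obtain K where "\<forall>y\<in>N ` cball z 2. norm y \<le> K" unfolding bounded_iff by blast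
    then have K: "\<bar>N w\<bar> \<le> K" if "w \<in> cball z 2" for w using that by auto
    have FK: "norm (F w x) \<le> K * \<bar>B x\<bar>" if "w \<in> cball z 2" for w x
    proof -
      have "norm (F w x) \<le> \<bar>N w * B x\<bar>" using bd[of w x] by linarith
      also have "\<dots> \<le> K * \<bar>B x\<bar>" unfolding abs_mult using K[OF that] by (intro mult_right_mono) auto
      finally show ?thesis .
    qed
    define d where "d x = deriv (\<lambda>z. F z x) z" for x
    have der: "((\<lambda>h. (F (z + h) x - F z x) / h) \<longlongrightarrow> d x) (at 0)" for x
      using holomorphic_derivI[OF hol open_UNIV UNIV_I, of x z UNIV] unfolding d_def DERIV_def .
    \<comment> \<open>The derivative in the parameter is measurable in \<open>x\<close> as a
      pointwise limit of difference quotients along a sequence.\<close>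
    have d_meas[measurable]: "d \<in> borel_measurable M"
    proof (rule borel_measurable_LIMSEQ_metric)
      show "(\<lambda>x. (F (z + 1 / of_nat (Suc n)) x - F z x) / (1 / of_nat (Suc n))) \<in> borel_measurable M" for n
        by measurable
      have "filterlim (\<lambda>n. 1 / of_nat (Suc n) :: complex) (at 0) sequentially"
        unfolding filterlim_at using LIMSEQ_Suc[OF lim_1_over_n] by (auto simp del: of_nat_Suc)
      then show "(\<lambda>n. (F (z + 1 / of_nat (Suc n)) x - F z x) / (1 / of_nat (Suc n))) \<longlonglongrightarrow> d x" for x
        using der[of x] by (rule filterlim_compose[rotated])
    qed
    have "((\<lambda>h. ((LINT x|M. F (z + h) x) - (LINT x|M. F z x)) / h) \<longlongrightarrow> (LINT x|M. d x)) (at 0 within ball 0 1)"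
      unfolding tendsto_at_iff_sequentially o_def
    proof safe
      fix X :: "nat \<Rightarrow> complex" assume X: "\<forall>i. X i \<in> ball 0 1 - {0}" "X \<longlonglongrightarrow> 0"
      have "(\<lambda>i. LINT x|M. (F (z + X i) x - F z x) / X i) \<longlonglongrightarrow> (LINT x|M. d x)"
      proof (rule integral_dominated_convergence)
        show "integrable M (\<lambda>x. K * \<bar>B x\<bar>)" using B by auto
        have "filterlim X (at 0) sequentially" using X unfolding filterlim_at by auto
        then show "AE x in M. (\<lambda>i. (F (z + X i) x - F z x) / X i) \<longlonglongrightarrow> d x"
          using filterlim_compose[OF der] by auto
        fix i
        have Xi: "X i \<noteq> 0" "z + X i \<in> ball z 1" using X(1)[rule_format, of i] by (auto simp: dist_norm)
        show "AE x in M. norm ((F (z + X i) x - F z x) / X i) \<le> K * \<bar>B x\<bar>"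
        proof (rule AE_I2)
          fix x
          have "norm (F (z + X i) x - F z x) \<le> K * \<bar>B x\<bar> * norm (z + X i - z)"
            by (rule holomorphic_deriv_bound_unit[OF hol FK Xi(2)])
          then show "norm ((F (z + X i) x - F z x) / X i) \<le> K * \<bar>B x\<bar>"
            using Xi(1) by (simp add: norm_divide divide_le_eq)
        qed
      qed measurable
      then show "(\<lambda>i. ((LINT x|M. F (z + X i) x) - (LINT x|M. F z x)) / X i) \<longlonglongrightarrow> (LINT x|M. d x)"
        using int by simp
    qed
    then have "((\<lambda>z. LINT x|M. F z x) has_field_derivative (LINT x|M. d x)) (at z)"
      unfolding DERIV_def by (subst (asm) at_within_open) auto
    then show ?thesis ..
  qed
  then show ?thesis by (auto simp: holomorphic_on_def field_differentiable_def)
qed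

section \<open>Integrability of Gaussians\<close>

lemma integrable_gaussian_1:
  fixes c :: real
  assumes "c > 0"
  shows "integrable lborel (\<lambda>x. exp (- c * x\<^sup>2))"
proof -
  define s where "s = sqrt (1 / (2 * c))"
  have s: "s > 0" "2 * s\<^sup>2 = 1 / c" using assms by (auto simp: s_def)
  have "integrable lborel (normal_density 0 s)" using s by (intro integrable_normal_density)
  then have "integrable lborel (\<lambda>x. sqrt (2 * pi * s\<^sup>2) * normal_density 0 s x)" by (rule integrable_mult_right)
  moreover have "sqrt (2 * pi * s\<^sup>2) * normal_density 0 s x = exp (- c * x\<^sup>2)" for x
    using s assms by (simp add: normal_density_def)
  ultimately show ?thesis by simp
qed

lemma integrable_gaussian:
  fixes c :: real
  assumes "c > 0"
  shows "integrable lborel (\<lambda>x::'a::euclidean_space. exp (- c * (norm x)\<^sup>2))"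
proof -
  have eq: "exp (- c * (norm x)\<^sup>2) = (\<Prod>b\<in>Basis. exp (- c * (x \<bullet> b)\<^sup>2))" for x :: 'a
  proof -
    have "(norm x)\<^sup>2 = (\<Sum>b\<in>Basis. (x \<bullet> b)\<^sup>2)"
      unfolding power2_norm_eq_inner by (subst euclidean_inner) (simp add: power2_eq_square)
    then show ?thesis by (simp add: exp_sum[symmetric] sum_distrib_left)
  qed
  have "(\<integral>\<^sup>+x. ennreal (exp (- c * (norm x)\<^sup>2)) \<partial>(lborel :: 'a measure)) = (\<integral>\<^sup>+x. (\<Prod>b\<in>Basis. ennreal (exp (- c * (x \<bullet> b)\<^sup>2))) \<partial>(lborel :: 'a measure))"
    unfolding eq by (simp add: prod_ennreal)
  also have "\<dots> = (\<Prod>b\<in>(Basis :: 'a set). (\<integral>\<^sup>+x. ennreal (exp (- c * x\<^sup>2)) \<partial>lborel))"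
    by (rule nn_integral_lborel_prod) auto
  also have "\<dots> = (\<Prod>b\<in>(Basis :: 'a set). ennreal (LINT x|lborel. exp (- c * x\<^sup>2)))"
    by (intro prod.cong refl nn_integral_eq_integral integrable_gaussian_1 assms) auto
  also have "\<dots> = ennreal (\<Prod>b\<in>(Basis :: 'a set). (LINT x|lborel. exp (- c * x\<^sup>2)))"
    by (rule prod_ennreal) simp
  also have "\<dots> < \<infinity>" by simp
  finally show ?thesis
    by (intro integrableI_bounded) auto
qed

lemma integrable_gaussian_vec:
  fixes c :: "real ^ 'd"
  assumes "\<And>l. c $ l > 0"
  shows "integrable lborel (\<lambda>x::real ^ 'd. exp (- (\<Sum>l\<in>UNIV. c $ l * (x $ l)\<^sup>2)))"
proof -
  define m where "m = Min (range (($) c))"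
  have m: "m > 0" unfolding m_def using assms by (subst Min_gr_iff) auto
  have "m * (norm x)\<^sup>2 \<le> (\<Sum>l\<in>UNIV. c $ l * (x $ l)\<^sup>2)" for x :: "real ^ 'd"
  proof -
    have "m * (norm x)\<^sup>2 = (\<Sum>l\<in>UNIV. m * (x $ l)\<^sup>2)"
      unfolding power2_norm_eq_inner inner_vec_def by (simp add: sum_distrib_left power2_eq_square)
    also have "\<dots> \<le> (\<Sum>l\<in>UNIV. c $ l * (x $ l)\<^sup>2)"
      by (intro sum_mono mult_right_mono) (auto simp: m_def)
    finally show ?thesis .
  qed
  then show ?thesis
    by (intro Bochner_Integration.integrable_bound[OF integrable_gaussian[OF m]]) auto
qed

section \<open>Complexified short time Fourier transform\<close>

abbreviation cvec :: "real ^ 'd \<Rightarrow> complex ^ 'd" where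
  "cvec x \<equiv> complex_vec x 0"

definition cnj_vec :: "complex ^ 'd \<Rightarrow> complex ^ 'd" where
  "cnj_vec z = (\<chi> l. cnj (z $ l))"

definition Re_vec :: "complex ^ 'd \<Rightarrow> real ^ 'd" where
  "Re_vec z = (\<chi> l. Re (z $ l))"

definition Im_vec :: "complex ^ 'd \<Rightarrow> real ^ 'd" where
  "Im_vec z = (\<chi> l. Im (z $ l))"

lemma complex_vec_Re_Im: "complex_vec (Re_vec z) (Im_vec z) = z"
  by (simp add: complex_vec_def Re_vec_def Im_vec_def vec_eq_iff complex_eq_iff)

lemma cvec_nth [simp]: "cvec x $ l = of_real (x $ l)"
  by (simp add: complex_vec_def complex_eq_iff)

lemma bounded_linear_cvec: "bounded_linear (cvec :: real ^ 'd \<Rightarrow> complex ^ 'd)"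
  by (auto simp: linear_conv_bounded_linear[symmetric] vec_eq_iff complex_eq_iff intro!: linearI)

lemma bounded_linear_cnj_vec: "bounded_linear (cnj_vec :: complex ^ 'd \<Rightarrow> complex ^ 'd)"
  by (auto simp: linear_conv_bounded_linear[symmetric] cnj_vec_def vec_eq_iff complex_eq_iff intro!: linearI)

lemma bounded_linear_smult_vec: "bounded_linear (\<lambda>z::complex. z *s (p :: complex ^ 'd))"
  by (auto simp: linear_conv_bounded_linear[symmetric] vec_eq_iff complex_eq_iff algebra_simps intro!: linearI)

text \<open>Complex linearity of the Frechet derivative \<open>D\<close> turns the derivative along
  the line into multiplication by \<open>D b\<close>.\<close>

lemma entire_holomorphic_line:
  assumes "entire G"
  shows "(\<lambda>z. G (a + z *s b)) holomorphic_on UNIV"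
proof -
  have "\<exists>D. ((\<lambda>z. G (a + z *s b)) has_field_derivative D) (at z)" for z
  proof -
    obtain D where D: "(G has_derivative D) (at (a + z *s b))" "\<And>c v. D (c *s v) = c * D v"
      using assms unfolding entire_def by blast
    have "((\<lambda>z. a + z *s b) has_derivative (\<lambda>h. h *s b)) (at z)"
      using has_derivative_add[OF has_derivative_const bounded_linear.has_derivative[OF bounded_linear_smult_vec has_derivative_ident]]
      by simp
    then have "((\<lambda>z. G (a + z *s b)) has_derivative (\<lambda>h. D (h *s b))) (at z)"
      using D(1) by (rule has_derivative_compose)
    moreover have "(\<lambda>h. D (h *s b)) = (*) (D b)" by (auto simp: D(2) mult.commute)
    ultimately show ?thesis unfolding has_field_derivative_def by auto
  qed
  then show ?thesis by (auto simp: holomorphic_on_def field_differentiable_def)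
qed

lemma entire_continuous: "entire G \<Longrightarrow> continuous_on UNIV G"
  unfolding entire_def by (meson continuous_at_imp_continuous_on has_derivative_continuous)

lemma gauss_entire_bound:
  assumes "G \<in> gauss_entire \<tau>' \<tau>"
  obtains C where "C \<ge> 0" "\<And>z. cmod (G z) \<le> C * exp (\<Sum>l\<in>UNIV. \<tau> $ l * (Im (z $ l))\<^sup>2 - \<tau>' $ l * (Re (z $ l))\<^sup>2)"
proof -
  obtain C where C: "\<And>x y. cmod (G (complex_vec x y)) \<le>
            C * (\<Prod>l\<in>UNIV. exp (- (\<tau>' $ l) * (x $ l)\<^sup>2) * exp (\<tau> $ l * (y $ l)\<^sup>2))"
    using assms unfolding gauss_entire_def by blast
  have bd: "cmod (G z) \<le> C * exp (\<Sum>l\<in>UNIV. \<tau> $ l * (Im (z $ l))\<^sup>2 - \<tau>' $ l * (Re (z $ l))\<^sup>2)" for z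
  proof -
    have "(\<Prod>l\<in>UNIV. exp (- (\<tau>' $ l) * (Re_vec z $ l)\<^sup>2) * exp (\<tau> $ l * (Im_vec z $ l)\<^sup>2))
      = exp (\<Sum>l\<in>UNIV. \<tau> $ l * (Im (z $ l))\<^sup>2 - \<tau>' $ l * (Re (z $ l))\<^sup>2)"
      by (simp add: exp_sum Re_vec_def Im_vec_def exp_diff exp_minus field_simps)
    then show ?thesis using C[of "Re_vec z" "Im_vec z"] by (simp add: complex_vec_Re_Im)
  qed
  moreover have "C \<ge> 0"
    using order_trans[OF norm_ge_zero bd[of 0]] by simp
  ultimately show ?thesis using that by blast
qed

text \<open>The derivative is conjugated inside and outside, hence complex-linear again, and the
  growth bound is even in \<open>y\<close>.\<close>

lemma gauss_entire_cnj:
  assumes "G \<in> gauss_entire \<tau>' \<tau>"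
  shows "(\<lambda>z. cnj (G (cnj_vec z))) \<in> gauss_entire \<tau>' \<tau>"
proof -
  have "entire (\<lambda>z. cnj (G (cnj_vec z)))"
    unfolding entire_def
  proof
    fix z
    have "entire G" using assms by (simp add: gauss_entire_def)
    then obtain D where D: "(G has_derivative D) (at (cnj_vec z))" "\<And>c v. D (c *s v) = c * D v"
      unfolding entire_def by blast
    have "(cnj_vec has_derivative cnj_vec) (at z)"
      by (rule bounded_linear_imp_has_derivative[OF bounded_linear_cnj_vec])
    then have "((\<lambda>z. G (cnj_vec z)) has_derivative (\<lambda>v. D (cnj_vec v))) (at z)"
      using D(1) by (rule has_derivative_compose)
    then have "((\<lambda>z. cnj (G (cnj_vec z))) has_derivative (\<lambda>v. cnj (D (cnj_vec v)))) (at z)"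
      by (rule bounded_linear.has_derivative[OF bounded_linear_cnj])
    moreover have "cnj_vec (c *s v) = cnj c *s cnj_vec v" for c and v :: "complex ^ 'a"
      by (simp add: cnj_vec_def vec_eq_iff)
    ultimately show "\<exists>D. ((\<lambda>z. cnj (G (cnj_vec z))) has_derivative D) (at z) \<and> (\<forall>c v. D (c *s v) = c * D v)"
      using D(2) by (intro exI[of _ "\<lambda>v. cnj (D (cnj_vec v))"]) auto
  qed
  moreover obtain C where C: "\<And>x y. cmod (G (complex_vec x y)) \<le>
            C * (\<Prod>l\<in>UNIV. exp (- (\<tau>' $ l) * (x $ l)\<^sup>2) * exp (\<tau> $ l * (y $ l)\<^sup>2))"
    using assms unfolding gauss_entire_def by blast
  moreover have "cnj_vec (complex_vec x y) = complex_vec x (- y)" for x y :: "real ^ 'a"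
    by (simp add: cnj_vec_def complex_vec_def vec_eq_iff complex_eq_iff)
  then have "cmod (cnj (G (cnj_vec (complex_vec x y)))) \<le>
            C * (\<Prod>l\<in>UNIV. exp (- (\<tau>' $ l) * (x $ l)\<^sup>2) * exp (\<tau> $ l * (y $ l)\<^sup>2))" for x y
    using C[of x "- y"] by simp
  ultimately show ?thesis unfolding gauss_entire_def by blast
qed

text \<open>Two passes of the identity theorem: along real lines through \<open>x0\<close>, which
  reach every real point, and along the line from \<open>Re_vec z\<close> in direction
  \<open>Im_vec z\<close>, which is real for real parameters and meets \<open>z\<close> at
  \<open>\<i>\<close>.\<close>

lemma entire_zero_on_real_open:
  assumes G: "entire G" and U: "open U" "x0 \<in> U" "\<And>x. x \<in> U \<Longrightarrow> G (cvec x) = 0"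
  shows "G = (\<lambda>z. 0)"
proof -
  have real0: "G (cvec x) = 0" for x
  proof -
    obtain e where e: "e > 0" "ball x0 e \<subseteq> U" using U by (meson open_contains_ball)
    define p where "p = x - x0"
    have "G (cvec x0 + 1 *s cvec p) = 0"
    proof (rule holomorphic_zero_near_0[OF entire_holomorphic_line[OF G], of "e / (norm p + 1)"])
      show "e / (norm p + 1) > 0" using e by (simp add: add_nonneg_pos)
      fix r :: real assume "0 < r" "r < e / (norm p + 1)"
      then have r: "\<bar>r\<bar> < e / (norm p + 1)" by simp
      have "\<bar>r\<bar> * norm p \<le> \<bar>r\<bar> * (norm p + 1)" by (intro mult_left_mono) auto
      also have "\<dots> < e" using r by (simp add: pos_less_divide_eq add_nonneg_pos)
      finally have "x0 + r *\<^sub>R p \<in> U" using e by (auto simp: dist_norm)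
      moreover have "cvec x0 + of_real r *s cvec p = cvec (x0 + r *\<^sub>R p)" by (simp add: vec_eq_iff)
      ultimately show "G (cvec x0 + of_real r *s cvec p) = 0" using U by simp
    qed
    moreover have "cvec x0 + 1 *s cvec p = cvec x" by (simp add: vec_eq_iff p_def)
    ultimately show ?thesis by simp
  qed
  show ?thesis
  proof
    fix z
    have "G (cvec (Re_vec z) + \<i> *s cvec (Im_vec z)) = 0"
    proof (rule holomorphic_zero_near_0[OF entire_holomorphic_line[OF G], of 1])
      fix r :: real
      have "cvec (Re_vec z) + of_real r *s cvec (Im_vec z) = cvec (Re_vec z + r *\<^sub>R Im_vec z)" by (simp add: vec_eq_iff)
      then show "G (cvec (Re_vec z) + of_real r *s cvec (Im_vec z)) = 0" using real0 by simp
    qed auto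
    moreover have "cvec (Re_vec z) + \<i> *s cvec (Im_vec z) = z"
      by (simp add: vec_eq_iff Re_vec_def Im_vec_def complex_eq_iff)
    ultimately show "G z = 0" by simp
  qed
qed

text \<open>With \<open>G z = cnj (g (cnj z))\<close> this extends the short time Fourier transform with window \<open>g\<close>
  to complex \<open>t\<close> and \<open>w\<close>, where \<open>w = - 2 * pi * \<omega>\<close>.\<close>
definition STFT_ext :: "(complex ^ 'd \<Rightarrow> complex) \<Rightarrow> (real ^ 'd \<Rightarrow> complex) \<Rightarrow> complex ^ 'd \<Rightarrow> complex ^ 'd \<Rightarrow> complex" where
  "STFT_ext G f t w = (LINT x|lborel. f x * (G (cvec x - t) * exp (\<i> * (\<Sum>l\<in>UNIV. of_real (x $ l) * w $ l))))"

text \<open>Completing the square in \<open>- \<tau>' * (x - Re t)\<^sup>2 - x * Im w\<close> gives the Gaussian centred at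
  \<open>centre \<tau>' t w\<close> and the remainder that enters \<open>growth \<tau>' \<tau> t w\<close>.\<close>
definition growth :: "real ^ 'd \<Rightarrow> real ^ 'd \<Rightarrow> complex ^ 'd \<Rightarrow> complex ^ 'd \<Rightarrow> real" where
  "growth \<tau>' \<tau> t w = (\<Sum>l\<in>UNIV. \<tau> $ l * (Im (t $ l))\<^sup>2 - Re (t $ l) * Im (w $ l) + (Im (w $ l))\<^sup>2 / (4 * \<tau>' $ l))"

definition centre :: "real ^ 'd \<Rightarrow> complex ^ 'd \<Rightarrow> complex ^ 'd \<Rightarrow> real ^ 'd" where
  "centre \<tau>' t w = (\<chi> l. Re (t $ l) - Im (w $ l) / (2 * \<tau>' $ l))"

lemma cnj_vec_line: "cnj_vec (t + z *s p) = cnj_vec t + cnj z *s cnj_vec p"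
  by (simp add: cnj_vec_def vec_eq_iff)

lemma cnj_vec_cvec [simp]: "cnj_vec (cvec x) = cvec x"
  by (simp add: cnj_vec_def vec_eq_iff)

definition STFT_sq :: "(complex ^ 'd \<Rightarrow> complex) \<Rightarrow> (real ^ 'd \<Rightarrow> complex) \<Rightarrow> complex ^ 'd \<Rightarrow> complex ^ 'd \<Rightarrow> complex" where
  "STFT_sq G f t w = STFT_ext G f t w * cnj (STFT_ext G f (cnj_vec t) (cnj_vec w))"

lemma STFT_sq_cvec: "STFT_sq G f (cvec t) (cvec w) = of_real ((cmod (STFT_ext G f (cvec t) (cvec w)))\<^sup>2)"
  unfolding STFT_sq_def cnj_vec_cvec by (rule complex_norm_square[symmetric])

section \<open>Bounds and holomorphy of the extended transform\<close>

context
  fixes G :: "complex ^ 'd \<Rightarrow> complex" and \<tau> \<tau>' :: "real ^ 'd" and f :: "real ^ 'd \<Rightarrow> complex"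
  assumes G: "G \<in> gauss_entire \<tau>' \<tau>" and \<tau>': "\<And>l. \<tau>' $ l > 0"
    and f[measurable]: "f \<in> borel_measurable borel" and L2: "integrable lborel (\<lambda>x. (cmod (f x))\<^sup>2)"
begin

lemma G_entire: "entire G" using G by (simp add: gauss_entire_def)

lemma G_measurable[measurable]: "(\<lambda>x. G (cvec x - t)) \<in> borel_measurable borel"
  by (intro borel_measurable_continuous_onI continuous_on_compose2[OF entire_continuous[OF G_entire]]
      continuous_intros linear_continuous_on bounded_linear_cvec) auto

lemma kernel_measurable[measurable]:
  "(\<lambda>x. f x * (G (cvec x - t) * exp (\<i> * (\<Sum>l\<in>UNIV. of_real (x $ l) * w $ l)))) \<in> borel_measurable borel"
proof -
  have [measurable]: "(\<lambda>x::real ^ 'd. exp (\<i> * (\<Sum>l\<in>UNIV. of_real (x $ l) * w $ l))) \<in> borel_measurable borel"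
    by (intro borel_measurable_continuous_onI continuous_intros)
  show ?thesis by measurable
qed

lemma kernel_bound:
  obtains C where "C \<ge> 0" "\<And>x t w. cmod (G (cvec x - t) * exp (\<i> * (\<Sum>l\<in>UNIV. of_real (x $ l) * w $ l)))
    \<le> C * exp (growth \<tau>' \<tau> t w) * exp (- (\<Sum>l\<in>UNIV. \<tau>' $ l * ((x - centre \<tau>' t w) $ l)\<^sup>2))"
proof -
  obtain C where C: "C \<ge> 0" "\<And>z. cmod (G z) \<le> C * exp (\<Sum>l\<in>UNIV. \<tau> $ l * (Im (z $ l))\<^sup>2 - \<tau>' $ l * (Re (z $ l))\<^sup>2)"
    using gauss_entire_bound[OF G] by blast
  have "cmod (G (cvec x - t) * exp (\<i> * (\<Sum>l\<in>UNIV. of_real (x $ l) * w $ l)))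
    \<le> C * exp (growth \<tau>' \<tau> t w) * exp (- (\<Sum>l\<in>UNIV. \<tau>' $ l * ((x - centre \<tau>' t w) $ l)\<^sup>2))" for x t w
  proof -
    have "cmod (G (cvec x - t) * exp (\<i> * (\<Sum>l\<in>UNIV. of_real (x $ l) * w $ l)))
      = cmod (G (cvec x - t)) * exp (- (\<Sum>l\<in>UNIV. x $ l * Im (w $ l)))"
      by (simp add: norm_mult)
    also have "\<dots> \<le> C * exp (\<Sum>l\<in>UNIV. \<tau> $ l * (Im ((cvec x - t) $ l))\<^sup>2 - \<tau>' $ l * (Re ((cvec x - t) $ l))\<^sup>2) * exp (- (\<Sum>l\<in>UNIV. x $ l * Im (w $ l)))"
      by (intro mult_right_mono C) auto
    also have "\<dots> = C * exp (\<Sum>l\<in>UNIV. \<tau> $ l * (Im (t $ l))\<^sup>2 - \<tau>' $ l * (x $ l - Re (t $ l))\<^sup>2 - x $ l * Im (w $ l))"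
      by (simp add: mult.assoc exp_add[symmetric] sum_subtractf)
    also have "(\<Sum>l\<in>UNIV. \<tau> $ l * (Im (t $ l))\<^sup>2 - \<tau>' $ l * (x $ l - Re (t $ l))\<^sup>2 - x $ l * Im (w $ l))
      = growth \<tau>' \<tau> t w - (\<Sum>l\<in>UNIV. \<tau>' $ l * ((x - centre \<tau>' t w) $ l)\<^sup>2)"
      unfolding growth_def sum_subtractf[symmetric]
    proof (intro sum.cong refl)
      fix l
      have square: "- T * (X - A)\<^sup>2 - X * E = - A * E + E\<^sup>2 / (4 * T) - T * (X - A + E / (2 * T))\<^sup>2"
        if "T \<noteq> 0" for T X A E :: real
        using that by (simp add: power2_eq_square field_simps)
      have c: "(x - centre \<tau>' t w) $ l = x $ l - Re (t $ l) + Im (w $ l) / (2 * \<tau>' $ l)" by (simp add: centre_def)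
      have "\<tau>' $ l \<noteq> 0" using \<tau>'[of l] by simp
      from square[OF this, of "x $ l" "Re (t $ l)" "Im (w $ l)"]
      show "\<tau> $ l * (Im (t $ l))\<^sup>2 - \<tau>' $ l * (x $ l - Re (t $ l))\<^sup>2 - x $ l * Im (w $ l)
        = \<tau> $ l * (Im (t $ l))\<^sup>2 - Re (t $ l) * Im (w $ l) + (Im (w $ l))\<^sup>2 / (4 * \<tau>' $ l) - \<tau>' $ l * ((x - centre \<tau>' t w) $ l)\<^sup>2"
        unfolding c by linarith
    qed
    finally show ?thesis by (simp add: exp_diff exp_minus field_simps)
  qed
  with C(1) that show ?thesis by blast
qed

text \<open>Bounding the product of \<open>cmod (f x)\<close> and the Gaussian by the sum of their
  squares leaves the integral of a translated Gaussian, which does not depend on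
  \<open>centre \<tau>' t w\<close>; so one constant serves all complex \<open>t\<close> and
  \<open>w\<close>.\<close>

lemma STFT_ext_bound: "\<exists>K\<ge>0. \<forall>t w. cmod (STFT_ext G f t w) \<le> K * exp (growth \<tau>' \<tau> t w)"
proof -
  obtain C where C: "C \<ge> 0" "\<And>x t w. cmod (G (cvec x - t) * exp (\<i> * (\<Sum>l\<in>UNIV. of_real (x $ l) * w $ l)))
    \<le> C * exp (growth \<tau>' \<tau> t w) * exp (- (\<Sum>l\<in>UNIV. \<tau>' $ l * ((x - centre \<tau>' t w) $ l)\<^sup>2))"
    using kernel_bound by blast
  define \<psi> where "\<psi> x = exp (- (\<Sum>l\<in>UNIV. (2 *\<^sub>R \<tau>') $ l * (x $ l)\<^sup>2))" for x :: "real ^ 'd"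
  have \<psi>: "integrable lborel \<psi>" unfolding \<psi>_def using \<tau>' by (intro integrable_gaussian_vec) simp
  define I where "I = (LINT x|lborel. (cmod (f x))\<^sup>2) + (LINT x|lborel. \<psi> x)"
  have "cmod (STFT_ext G f t w) \<le> C * I * exp (growth \<tau>' \<tau> t w)" for t w
  proof -
    let ?E = "C * exp (growth \<tau>' \<tau> t w)"
    have \<psi>t: "integrable lborel (\<lambda>x. \<psi> (x - centre \<tau>' t w))" by (rule lborel_integrable_translate(3)[OF \<psi>])
    have "cmod (STFT_ext G f t w) \<le> (LINT x|lborel. ?E * ((cmod (f x))\<^sup>2 + \<psi> (x - centre \<tau>' t w)))"
      unfolding STFT_ext_def
    proof (rule Bochner_Integration.integral_norm_bound_integral)
      show int: "integrable lborel (\<lambda>x. ?E * ((cmod (f x))\<^sup>2 + \<psi> (x - centre \<tau>' t w)))"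
        by (intro integrable_mult_right Bochner_Integration.integrable_add L2 \<psi>t)
      show bd: "norm (f x * (G (cvec x - t) * exp (\<i> * (\<Sum>l\<in>UNIV. of_real (x $ l) * w $ l)))) \<le> ?E * ((cmod (f x))\<^sup>2 + \<psi> (x - centre \<tau>' t w))" for x
      proof -
        let ?e = "exp (- (\<Sum>l\<in>UNIV. \<tau>' $ l * ((x - centre \<tau>' t w) $ l)\<^sup>2))"
        have "norm (f x * (G (cvec x - t) * exp (\<i> * (\<Sum>l\<in>UNIV. of_real (x $ l) * w $ l)))) \<le> cmod (f x) * (?E * ?e)"
          unfolding norm_mult[of "f x"] by (intro mult_left_mono C) auto
        also have "\<dots> = ?E * (cmod (f x) * ?e)" by simp
        also have "\<dots> \<le> ?E * ((cmod (f x))\<^sup>2 + ?e\<^sup>2)" using C(1) by (intro mult_left_mono mult_le_sum_squares) auto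
        also have "?e\<^sup>2 = \<psi> (x - centre \<tau>' t w)"
          by (simp add: \<psi>_def exp_double[symmetric] sum_distrib_left mult.assoc)
        finally show ?thesis .
      qed
      show "integrable lborel (\<lambda>x. f x * (G (cvec x - t) * exp (\<i> * (\<Sum>l\<in>UNIV. of_real (x $ l) * w $ l))))"
        by (rule Bochner_Integration.integrable_bound[OF int]) (auto intro!: order_trans[OF bd abs_ge_self])
    qed
    also have "\<dots> = ?E * ((LINT x|lborel. (cmod (f x))\<^sup>2) + (LINT x|lborel. \<psi> (x - centre \<tau>' t w)))"
      using L2 \<psi>t by simp
    also have "(LINT x|lborel. \<psi> (x - centre \<tau>' t w)) = (LINT x|lborel. \<psi> x)"
      using lborel_integral_translate[OF borel_measurable_integrable[OF \<psi>, simplified], of "- centre \<tau>' t w"] by simp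
    finally show ?thesis by (simp add: I_def mult_ac)
  qed
  moreover have "I \<ge> 0" unfolding I_def by (intro add_nonneg_nonneg integral_nonneg_AE) (auto simp: \<psi>_def)
  ultimately show ?thesis using C(1) by (intro exI[of _ "C * I"]) auto
qed

text \<open>A majorant for the parameter integral must not move with \<open>z\<close>, but the
  Gaussian of \<open>kernel_bound\<close> has a centre depending on \<open>z\<close>. Half of its
  rate is given up to recentre it at the origin, and the cost is absorbed in the continuous factor
  \<open>N\<close>.\<close>

lemma STFT_ext_holomorphic: "(\<lambda>z. STFT_ext G f (t + z *s p) (w + z *s q)) holomorphic_on UNIV"
proof -
  obtain C where C: "C \<ge> 0" "\<And>x t w. cmod (G (cvec x - t) * exp (\<i> * (\<Sum>l\<in>UNIV. of_real (x $ l) * w $ l)))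
    \<le> C * exp (growth \<tau>' \<tau> t w) * exp (- (\<Sum>l\<in>UNIV. \<tau>' $ l * ((x - centre \<tau>' t w) $ l)\<^sup>2))"
    using kernel_bound by blast
  define \<psi> where "\<psi> x = exp (- (\<Sum>l\<in>UNIV. ((1 / 2) *\<^sub>R \<tau>') $ l * (x $ l)\<^sup>2))" for x :: "real ^ 'd"
  have \<psi>2: "integrable lborel (\<lambda>x. (\<psi> x)\<^sup>2)"
  proof -
    have "(\<psi> x)\<^sup>2 = exp (- (\<Sum>l\<in>UNIV. \<tau>' $ l * (x $ l)\<^sup>2))" for x
      by (simp add: \<psi>_def exp_double[symmetric] sum_distrib_left mult.assoc)
    then show ?thesis using \<tau>' integrable_gaussian_vec[of \<tau>'] by simp
  qed
  define N where "N z = C * exp (growth \<tau>' \<tau> (t + z *s p) (w + z *s q)) * exp (\<Sum>l\<in>UNIV. \<tau>' $ l * (centre \<tau>' (t + z *s p) (w + z *s q) $ l)\<^sup>2)" for z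
  show ?thesis
    unfolding STFT_ext_def
  proof (rule holomorphic_parameter_integral)
    show "continuous_on UNIV N"
      unfolding N_def growth_def centre_def
      by (simp, intro continuous_intros) (use \<tau>' in \<open>auto simp: less_imp_neq[symmetric]\<close>)
    have [measurable]: "\<psi> \<in> borel_measurable borel"
      unfolding \<psi>_def by (intro borel_measurable_continuous_onI continuous_intros)
    have "integrable lborel (\<lambda>x. f x * of_real (\<psi> x))"
      by (intro integrable_mult_L2 L2) (auto simp: \<psi>2)
    then show "integrable lborel (\<lambda>x. cmod (f x * of_real (\<psi> x)))" by (rule integrable_norm)
    show "(\<lambda>x. f x * (G (cvec x - (t + z *s p)) * exp (\<i> * (\<Sum>l\<in>UNIV. of_real (x $ l) * (w + z *s q) $ l)))) \<in> borel_measurable lborel" for z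
      by measurable
    show "(\<lambda>z. f x * (G (cvec x - (t + z *s p)) * exp (\<i> * (\<Sum>l\<in>UNIV. of_real (x $ l) * (w + z *s q) $ l)))) holomorphic_on UNIV" for x
    proof -
      have line: "cvec x - (t + z *s p) = (cvec x - t) + z *s (- p)" for z by (simp add: vec_eq_iff)
      have "(\<lambda>z. G (cvec x - (t + z *s p))) holomorphic_on UNIV"
        unfolding line by (rule entire_holomorphic_line[OF G_entire])
      then show ?thesis by (auto intro!: holomorphic_intros)
    qed
    show "norm (f x * (G (cvec x - (t + z *s p)) * exp (\<i> * (\<Sum>l\<in>UNIV. of_real (x $ l) * (w + z *s q) $ l)))) \<le> N z * cmod (f x * of_real (\<psi> x))" for x z
    proof -
      define m where "m = centre \<tau>' (t + z *s p) (w + z *s q)"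
      define E where "E = C * exp (growth \<tau>' \<tau> (t + z *s p) (w + z *s q))"
      have E: "E \<ge> 0" using C(1) by (simp add: E_def)
      \<comment> \<open>Coordinatewise this is
        \<open>(x - m)\<^sup>2 \<ge> x\<^sup>2 / 2 - m\<^sup>2\<close>, equivalent to
        \<open>(x - 2 * m)\<^sup>2 \<ge> 0\<close>.\<close>
      have "- (\<Sum>l\<in>UNIV. \<tau>' $ l * ((x - m) $ l)\<^sup>2) \<le> (\<Sum>l\<in>UNIV. \<tau>' $ l * (m $ l)\<^sup>2) - (\<Sum>l\<in>UNIV. ((1 / 2) *\<^sub>R \<tau>') $ l * (x $ l)\<^sup>2)"
        unfolding sum_negf[symmetric] sum_subtractf[symmetric]
      proof (intro sum_mono)
        fix l
        have "0 \<le> \<tau>' $ l * (x $ l - 2 * m $ l)\<^sup>2" using less_imp_le[OF \<tau>'] by simp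
        then show "- (\<tau>' $ l * ((x - m) $ l)\<^sup>2) \<le> \<tau>' $ l * (m $ l)\<^sup>2 - ((1 / 2) *\<^sub>R \<tau>') $ l * (x $ l)\<^sup>2"
          by (simp add: power2_eq_square algebra_simps)
      qed
      then have *: "exp (- (\<Sum>l\<in>UNIV. \<tau>' $ l * ((x - m) $ l)\<^sup>2)) \<le> exp (\<Sum>l\<in>UNIV. \<tau>' $ l * (m $ l)\<^sup>2) * \<psi> x"
        unfolding \<psi>_def exp_add[symmetric] by simp
      have "norm (f x * (G (cvec x - (t + z *s p)) * exp (\<i> * (\<Sum>l\<in>UNIV. of_real (x $ l) * (w + z *s q) $ l))))
        \<le> cmod (f x) * (E * exp (- (\<Sum>l\<in>UNIV. \<tau>' $ l * ((x - m) $ l)\<^sup>2)))"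
        unfolding norm_mult[of "f x"] E_def m_def by (intro mult_left_mono C) auto
      also have "\<dots> \<le> cmod (f x) * (E * (exp (\<Sum>l\<in>UNIV. \<tau>' $ l * (m $ l)\<^sup>2) * \<psi> x))"
        by (intro mult_left_mono * E) auto
      also have "\<dots> = N z * cmod (f x * of_real (\<psi> x))"
        by (simp add: N_def E_def m_def norm_mult \<psi>_def)
      finally show ?thesis .
    qed
  qed
qed

lemma STFT_sq_holomorphic: "(\<lambda>z. STFT_sq G f (t + z *s p) (w + z *s q)) holomorphic_on UNIV"
proof -
  have "(\<lambda>z. STFT_ext G f (cnj_vec t + z *s cnj_vec p) (cnj_vec w + z *s cnj_vec q)) holomorphic_on (cnj ` UNIV)"
    by (rule holomorphic_on_subset[OF STFT_ext_holomorphic]) auto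
  then have "(cnj \<circ> (\<lambda>z. STFT_ext G f (cnj_vec t + z *s cnj_vec p) (cnj_vec w + z *s cnj_vec q)) \<circ> cnj) holomorphic_on UNIV"
    by (rule holomorphic_on_compose_cnj_cnj) auto
  then show ?thesis
    unfolding STFT_sq_def cnj_vec_line o_def
    by (intro holomorphic_on_mult STFT_ext_holomorphic)
qed

text \<open>The mixed terms \<open>Re t * Im w\<close> of the growth exponents at \<open>(t, w)\<close> and \<open>(cnj t, cnj w)\<close> cancel.\<close>
lemma STFT_sq_bound:
  "\<exists>K\<ge>0. \<forall>t w. cmod (STFT_sq G f t w) \<le> K * exp (2 * (\<Sum>l\<in>UNIV. \<tau> $ l * (Im (t $ l))\<^sup>2 + (Im (w $ l))\<^sup>2 / (4 * \<tau>' $ l)))"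
proof -
  obtain K where K: "K \<ge> 0" "\<And>t w. cmod (STFT_ext G f t w) \<le> K * exp (growth \<tau>' \<tau> t w)"
    using STFT_ext_bound by blast
  have "cmod (STFT_sq G f t w) \<le> K * K * exp (2 * (\<Sum>l\<in>UNIV. \<tau> $ l * (Im (t $ l))\<^sup>2 + (Im (w $ l))\<^sup>2 / (4 * \<tau>' $ l)))" for t w
  proof -
    have "cmod (STFT_sq G f t w) \<le> (K * exp (growth \<tau>' \<tau> t w)) * (K * exp (growth \<tau>' \<tau> (cnj_vec t) (cnj_vec w)))"
      unfolding STFT_sq_def norm_mult complex_mod_cnj using K(1) by (intro mult_mono K) auto
    also have "\<dots> = K * K * exp (growth \<tau>' \<tau> t w + growth \<tau>' \<tau> (cnj_vec t) (cnj_vec w))"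
      by (simp add: exp_add)
    also have "growth \<tau>' \<tau> t w + growth \<tau>' \<tau> (cnj_vec t) (cnj_vec w)
      = 2 * (\<Sum>l\<in>UNIV. \<tau> $ l * (Im (t $ l))\<^sup>2 + (Im (w $ l))\<^sup>2 / (4 * \<tau>' $ l))"
      unfolding growth_def sum.distrib[symmetric] sum_distrib_left
      by (intro sum.cong) (auto simp: cnj_vec_def)
    finally show ?thesis .
  qed
  then show ?thesis using K(1) by (intro exI[of _ "K * K"]) auto
qed

end

section \<open>Phase retrieval\<close>

text \<open>Induction on the set \<open>S\<close> of coordinates already freed from the grid: to
  free \<open>j\<close>, \<open>step\<close> asks only for points whose \<open>j\<close>-th
  coordinate is on the grid, and these are covered by the induction hypothesis.\<close>

lemma vanishing_coordinatewise:
  fixes \<Phi> :: "real ^ 'd \<Rightarrow> complex" and A :: "'d \<Rightarrow> real set"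
  assumes step: "\<And>l t. (\<And>r. r \<in> A l \<Longrightarrow> \<Phi> (\<chi> k. if k = l then r else t $ k) = 0) \<Longrightarrow> \<Phi> t = 0"
    and zero: "\<And>t. (\<And>l. t $ l \<in> A l) \<Longrightarrow> \<Phi> t = 0"
  shows "\<Phi> t = 0"
proof -
  have "\<forall>t. (\<forall>l. l \<notin> S \<longrightarrow> t $ l \<in> A l) \<longrightarrow> \<Phi> t = 0" if "finite S" for S
    using that
  proof (induction S rule: finite_induct)
    case empty
    then show ?case using zero by auto
  next
    case (insert j S)
    show ?case
    proof (intro allI impI)
      fix t assume t: "\<forall>l. l \<notin> insert j S \<longrightarrow> t $ l \<in> A l"
      show "\<Phi> t = 0"
      proof (rule step)
        fix r assume "r \<in> A j"
        then show "\<Phi> (\<chi> k. if k = j then r else t $ k) = 0"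
          using t by (intro insert.IH[rule_format]) auto
      qed
    qed
  qed
  from this[of UNIV] show ?thesis by simp
qed

section \<open>From Lebesgue to Borel measurable functions\<close>

lemma STFT_ext_real:
  "STFT_ext (\<lambda>z. cnj (g (cnj_vec z))) f (cvec t) (cvec w) = (LINT x|lborel. f x * cnj (g (cvec (x - t))) * iexp (x \<bullet> w))"
proof -
  have "cnj_vec (cvec x - cvec t) = cvec (x - t)" for x
    by (simp add: cnj_vec_def vec_eq_iff)
  moreover have "(\<Sum>l\<in>UNIV. of_real (x $ l) * cvec w $ l) = complex_of_real (x \<bullet> w)" for x
    by (simp add: inner_vec_def)
  ultimately show ?thesis unfolding STFT_ext_def by (simp add: mult.assoc)
qed

lemma STFT_eq_STFT_ext:
  assumes f0: "f0 \<in> borel_measurable lebesgue" and f: "f \<in> borel_measurable borel"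
    and eq: "AE x in lborel. f0 x = f x" and G: "entire g"
  shows "STFT (\<lambda>x. g (cvec x)) f0 t \<omega> = STFT_ext (\<lambda>z. cnj (g (cnj_vec z))) f (cvec t) (cvec (- (2 * pi) *\<^sub>R \<omega>))"
proof -
  define k where "k x = cnj (g (cvec (x - t))) * exp (- 2 * of_real pi * \<i> * of_real (x \<bullet> \<omega>))" for x
  have "continuous_on UNIV (\<lambda>x. g (cvec (x - t)))"
    by (rule continuous_on_compose2[OF entire_continuous[OF G]])
       (auto intro!: bounded_linear.continuous_on[OF bounded_linear_cvec] continuous_intros)
  then have "continuous_on UNIV k"
    unfolding k_def by (intro continuous_intros)
  then have k[measurable]: "k \<in> borel_measurable borel" by (rule borel_measurable_continuous_onI)
  have fk: "(\<lambda>x. f x * k x) \<in> borel_measurable lborel" using f by simp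
  have k': "k \<in> borel_measurable lebesgue" using k by (intro measurable_completion) simp
  have "STFT (\<lambda>x. g (cvec x)) f0 t \<omega> = (LINT x|lebesgue. f0 x * k x)"
    by (simp add: STFT_def k_def mult.assoc)
  also have "\<dots> = (LINT x|lebesgue. f x * k x)"
  proof (rule integral_cong_AE)
    show "(\<lambda>x. f0 x * k x) \<in> borel_measurable lebesgue" using f0 k' by measurable
    show "(\<lambda>x. f x * k x) \<in> borel_measurable lebesgue" using fk by (rule measurable_completion)
    show "AE x in lebesgue. f0 x * k x = f x * k x" using AE_completion[OF eq] by eventually_elim simp
  qed
  also have "\<dots> = (LINT x|lborel. f x * k x)" by (rule integral_completion[OF fk])
  also have "\<dots> = STFT_ext (\<lambda>z. cnj (g (cnj_vec z))) f (cvec t) (cvec (- (2 * pi) *\<^sub>R \<omega>))"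
    unfolding STFT_ext_real k_def by (intro Bochner_Integration.integral_cong) (auto simp: mult_ac)
  finally show ?thesis .
qed

text \<open>The exchange of quantifiers takes place on the product of two copies of
  \<open>lborel\<close>, while members of \<open>L2_fun\<close> are only Lebesgue measurable; a
  Borel function equal almost everywhere has the same integrals.\<close>

lemma L2_fun_borel_representative:
  assumes "f \<in> L2_fun"
  obtains f' where "f' \<in> borel_measurable borel" "integrable lborel (\<lambda>x. (cmod (f' x))\<^sup>2)"
    "AE x in lborel. f x = f' x"
proof -
  have meas: "f \<in> borel_measurable (completion lborel)" and int: "integrable (completion lborel) (\<lambda>x. (cmod (f x))\<^sup>2)"
    using assms by (auto simp: L2_fun_def)
  have "(\<lambda>x. Re (f x)) \<in> borel_measurable (completion lborel)" "(\<lambda>x. Im (f x)) \<in> borel_measurable (completion lborel)"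
    using meas by measurable
  note ReIm = this[THEN completion_ex_borel_measurable_real]
  obtain u where u: "u \<in> borel_measurable lborel" "AE x in lborel. Re (f x) = u x"
    using ReIm(1) by blast
  obtain v where v: "v \<in> borel_measurable lborel" "AE x in lborel. Im (f x) = v x"
    using ReIm(2) by blast
  define f' where "f' x = Complex (u x) (v x)" for x
  have [measurable]: "u \<in> borel_measurable borel" "v \<in> borel_measurable borel" using u(1) v(1) by simp_all
  have m[measurable]: "f' \<in> borel_measurable borel" unfolding f'_def Complex_eq by measurable
  have eq: "AE x in lborel. f x = f' x"
    using u(2) v(2) by eventually_elim (simp add: f'_def complex_eq_iff)
  have "integrable (completion lborel) (\<lambda>x. (cmod (f' x))\<^sup>2)"
  proof (subst integrable_cong_AE[symmetric])
    show "AE x in completion lborel. (cmod (f x))\<^sup>2 = (cmod (f' x))\<^sup>2"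
      using AE_completion[OF eq] by eventually_elim simp
    show "(\<lambda>x. (cmod (f x))\<^sup>2) \<in> borel_measurable (completion lborel)" using meas by measurable
    show "(\<lambda>x. (cmod (f' x))\<^sup>2) \<in> borel_measurable (completion lborel)"
      by (intro measurable_completion) measurable
  qed (rule int)
  then have "integrable lborel (\<lambda>x. (cmod (f' x))\<^sup>2)"
    by (subst (asm) integrable_completion) measurable
  then show ?thesis using m eq that by blast
qed

text \<open>If the transform vanished on an open set, it would vanish identically by the identity
  theorem along lines. Injectivity and continuity would then give
  \<open>cnj (g (cvec (u + s))) * g (cvec u) = 0\<close> for all \<open>u\<close>, so
  \<open>g\<close> would be zero on the translate by \<open>s\<close> of the nonempty open set where
  it is nonzero.\<close>

lemma window_transform_nonzero:
  fixes g :: "complex ^ 'd \<Rightarrow> complex"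
  assumes g: "g \<in> gauss_entire \<tau>' \<tau>" and \<tau>': "\<And>l. \<tau>' $ l > 0" and g0: "g \<noteq> (\<lambda>z. 0)"
    and L2: "integrable lborel (\<lambda>x. (cmod (g (cvec x)))\<^sup>2)"
    and U: "open U" "U \<noteq> {}"
  shows "\<exists>w\<in>U. (LINT u|lborel. cnj (g (cvec (u + s))) * g (cvec u) * iexp (- (u \<bullet> w))) \<noteq> 0"
proof (rule ccontr)
  have ent: "entire g" using g by (simp add: gauss_entire_def)
  have cont: "continuous_on UNIV (\<lambda>x. g (cvec x))"
    by (intro continuous_on_compose2[OF entire_continuous[OF ent]] linear_continuous_on bounded_linear_cvec) auto
  then have [measurable]: "(\<lambda>x. g (cvec x)) \<in> borel_measurable borel" by (rule borel_measurable_continuous_onI)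
  define f where "f u = cnj (g (cvec (u + s)))" for u
  have f: "f \<in> borel_measurable borel" unfolding f_def by measurable
  have f2: "integrable lborel (\<lambda>x. (cmod (f x))\<^sup>2)"
    unfolding f_def using lborel_integrable_translate(2)[OF L2] by simp
  define J where "J w = (LINT u|lborel. f u * g (cvec u) * iexp (- (u \<bullet> w)))" for w
  \<comment> \<open>The transform is itself an extended short time Fourier transform, at
    \<open>t = 0\<close> with signal \<open>f\<close>; its holomorphy is therefore already
    known.\<close>
  have J: "J w = STFT_ext g f 0 (cvec (- w))" for w
  proof -
    have "(\<Sum>l\<in>UNIV. of_real (x $ l) * cvec (- w) $ l) = - complex_of_real (x \<bullet> w)" for x
      by (simp add: inner_vec_def sum_negf)
    then show ?thesis unfolding STFT_ext_def J_def by (simp add: mult.assoc)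
  qed
  assume "\<not> (\<exists>w\<in>U. (LINT u|lborel. cnj (g (cvec (u + s))) * g (cvec u) * iexp (- (u \<bullet> w))) \<noteq> 0)"
  then have JU: "J w = 0" if "w \<in> U" for w using that by (auto simp: J_def f_def)
  obtain w0 e where w0: "e > 0" "ball w0 e \<subseteq> U" using U by (meson open_contains_ball ex_in_conv)
  have J0: "J w = 0" for w
  proof -
    define p where "p = w - w0"
    have hol: "(\<lambda>z. STFT_ext g f (0 + z *s 0) (cvec (- w0) + z *s cvec (- p))) holomorphic_on UNIV"
      by (rule STFT_ext_holomorphic[OF g \<tau>' f f2])
    have "STFT_ext g f (0 + 1 *s 0) (cvec (- w0) + 1 *s cvec (- p)) = 0"
    proof (rule holomorphic_zero_near_0[OF hol, of "e / (norm p + 1)"])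
      show "e / (norm p + 1) > 0" using w0 by (simp add: add_nonneg_pos)
      fix r :: real assume "0 < r" "r < e / (norm p + 1)"
      then have r: "\<bar>r\<bar> < e / (norm p + 1)" by simp
      have "\<bar>r\<bar> * norm p \<le> \<bar>r\<bar> * (norm p + 1)" by (intro mult_left_mono) auto
      also have "\<dots> < e" using r by (simp add: pos_less_divide_eq add_nonneg_pos)
      finally have "w0 + r *\<^sub>R p \<in> U" using w0 by (auto simp: dist_norm)
      moreover have "cvec (- w0) + of_real r *s cvec (- p) = cvec (- (w0 + r *\<^sub>R p))" by (simp add: vec_eq_iff)
      moreover have "of_real r *s 0 = (0 :: complex ^ 'd)" by (simp add: vec_eq_iff)
      ultimately show "STFT_ext g f (0 + of_real r *s 0) (cvec (- w0) + of_real r *s cvec (- p)) = 0"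
        using JU[of "w0 + r *\<^sub>R p"] by (simp add: J)
    qed
    moreover have "cvec (- w0) + 1 *s cvec (- p) = cvec (- w)" "1 *s 0 = (0 :: complex ^ 'd)" by (simp_all add: vec_eq_iff p_def)
    ultimately show ?thesis by (simp add: J)
  qed
  have "AE u in lborel. f u * g (cvec u) = 0"
  proof (rule fourier_zero_imp_AE_zero)
    show "integrable lborel (\<lambda>u. f u * g (cvec u))" by (intro integrable_mult_L2 f2 L2) (use f in auto)
    show "(LINT u|lborel. f u * g (cvec u) * iexp (u \<bullet> w)) = 0" for w
      using J0[of "- w"] by (simp add: J_def)
  qed
  then have "AE u in lebesgue. u \<in> {u. f u * g (cvec u) = 0}" by (intro AE_completion) simp
  moreover have "closed {u. f u * g (cvec u) = 0}"
    unfolding f_def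
    by (intro closed_Collect_eq continuous_on_mult continuous_on_cnj cont continuous_on_const
        continuous_on_compose2[OF cont]) (auto intro!: continuous_intros)
  ultimately have prod0: "f u * g (cvec u) = 0" for u
    using mem_closed_if_AE_lebesgue[of "{u. f u * g (cvec u) = 0}" u] by simp
  obtain x0 where x0: "g (cvec x0) \<noteq> 0"
    using entire_zero_on_real_open[OF ent open_UNIV] g0 by blast
  have "open {x. g (cvec x) \<noteq> 0}" by (intro open_Collect_neq cont continuous_on_const)
  then have "open ((+) s ` {x. g (cvec x) \<noteq> 0})" by (rule open_translation)
  moreover have "s + x0 \<in> (+) s ` {x. g (cvec x) \<noteq> 0}" using x0 by simp
  moreover have "g (cvec x) = 0" if "x \<in> (+) s ` {x. g (cvec x) \<noteq> 0}" for x
    using that prod0 by (auto simp: f_def add.commute)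
  ultimately have "g = (\<lambda>z. 0)" by (rule entire_zero_on_real_open[OF ent])
  with g0 show False by simp
qed

text \<open>With a real base point and a real direction, the bound of \<open>STFT_sq\<close> sees
  only \<open>Im z\<close>, with coefficient \<open>2 * \<sigma>\<close>, so the uniqueness theorem
  applies. The general direction covers moves in \<open>t\<close> and in \<open>w\<close>
  alike.\<close>

lemma STFT_sq_diff_zero_line:
  fixes G :: "complex ^ 'd \<Rightarrow> complex" and \<tau> \<tau>' :: "real ^ 'd" and f1 f2 :: "real ^ 'd \<Rightarrow> complex"
    and \<sigma> a :: real and lam :: "nat \<Rightarrow> real"
  defines "D \<equiv> \<lambda>t w. STFT_sq G f1 t w - STFT_sq G f2 t w"
  assumes G: "G \<in> gauss_entire \<tau>' \<tau>" and \<tau>': "\<And>l. \<tau>' $ l > 0"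
    and f1: "f1 \<in> borel_measurable borel" "integrable lborel (\<lambda>x. (cmod (f1 x))\<^sup>2)"
    and f2: "f2 \<in> borel_measurable borel" "integrable lborel (\<lambda>x. (cmod (f2 x))\<^sup>2)"
    and \<sigma>: "\<sigma> > 0" "\<sigma> = (\<Sum>l\<in>UNIV. \<tau> $ l * (p $ l)\<^sup>2 + (q $ l)\<^sup>2 / (4 * \<tau>' $ l))"
    and lam: "\<And>n. n \<ge> 1 \<Longrightarrow> lam n > 0" "strict_mono_on {1..} lam"
      "(\<lambda>n. lam n / sqrt (real n)) \<longlonglongrightarrow> a" "a < sqrt (pi / \<sigma>)"
    and zero: "\<And>n. n \<ge> 1 \<Longrightarrow> D (cvec (t + lam n *\<^sub>R p)) (cvec (w + lam n *\<^sub>R q)) = 0"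
  shows "D (cvec (t + r *\<^sub>R p)) (cvec (w + r *\<^sub>R q)) = 0"
proof -
  define h where "h z = D (cvec t + z *s cvec p) (cvec w + z *s cvec q)" for z
  have hr: "h (of_real r) = D (cvec (t + r *\<^sub>R p)) (cvec (w + r *\<^sub>R q))" for r
  proof -
    have "cvec u + of_real r *s cvec v = cvec (u + r *\<^sub>R v)" for u v :: "real ^ 'd" by (simp add: vec_eq_iff)
    then show ?thesis by (simp add: h_def)
  qed
  obtain K1 where K1: "K1 \<ge> 0" "\<And>t w. cmod (STFT_sq G f1 t w) \<le> K1 * exp (2 * (\<Sum>l\<in>UNIV. \<tau> $ l * (Im (t $ l))\<^sup>2 + (Im (w $ l))\<^sup>2 / (4 * \<tau>' $ l)))"
    using STFT_sq_bound[OF G \<tau>' f1] by blast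
  obtain K2 where K2: "K2 \<ge> 0" "\<And>t w. cmod (STFT_sq G f2 t w) \<le> K2 * exp (2 * (\<Sum>l\<in>UNIV. \<tau> $ l * (Im (t $ l))\<^sup>2 + (Im (w $ l))\<^sup>2 / (4 * \<tau>' $ l)))"
    using STFT_sq_bound[OF G \<tau>' f2] by blast
  have "h (of_real r) = 0"
  proof (rule entire_gaussian_zeros_imp_zero[where h = h, OF _ _ \<sigma>(1) lam])
    show "h holomorphic_on UNIV"
      unfolding h_def D_def
      by (intro holomorphic_on_diff STFT_sq_holomorphic[OF G \<tau>' f1] STFT_sq_holomorphic[OF G \<tau>' f2])
    show "h (of_real (lam n)) = 0" if "n \<ge> 1" for n using zero[OF that] by (simp add: hr)
    show "cmod (h z) \<le> (K1 + K2) * exp (2 * \<sigma> * (Im z)\<^sup>2)" for z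
    proof -
      have "2 * (\<Sum>l\<in>UNIV. \<tau> $ l * (Im ((cvec t + z *s cvec p) $ l))\<^sup>2 + (Im ((cvec w + z *s cvec q) $ l))\<^sup>2 / (4 * \<tau>' $ l)) = 2 * \<sigma> * (Im z)\<^sup>2"
        unfolding \<sigma>(2) sum_distrib_left sum_distrib_right by (intro sum.cong) (auto simp: power_mult_distrib algebra_simps)
      then have "cmod (STFT_sq G f1 (cvec t + z *s cvec p) (cvec w + z *s cvec q)) \<le> K1 * exp (2 * \<sigma> * (Im z)\<^sup>2)"
        "cmod (STFT_sq G f2 (cvec t + z *s cvec p) (cvec w + z *s cvec q)) \<le> K2 * exp (2 * \<sigma> * (Im z)\<^sup>2)"
        using K1(2)[of "cvec t + z *s cvec p" "cvec w + z *s cvec q"] K2(2)[of "cvec t + z *s cvec p" "cvec w + z *s cvec q"]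
        by (simp_all only:)
      then show ?thesis unfolding h_def D_def distrib_right by (intro order_trans[OF norm_triangle_ineq4] add_mono)
    qed
  qed
  then show ?thesis by (simp add: hr)
qed

lemma STFT_modulus_eq_on_reals:
  fixes G :: "complex ^ 'd \<Rightarrow> complex" and \<tau> \<tau>' :: "real ^ 'd" and f1 f2 :: "real ^ 'd \<Rightarrow> complex"
    and lam lam' :: "'d \<Rightarrow> nat \<Rightarrow> real" and a b :: "'d \<Rightarrow> real"
  assumes G: "G \<in> gauss_entire \<tau>' \<tau>" and \<tau>: "\<And>l. \<tau> $ l > 0" and \<tau>': "\<And>l. \<tau>' $ l > 0"
    and f1: "f1 \<in> borel_measurable borel" "integrable lborel (\<lambda>x. (cmod (f1 x))\<^sup>2)"
    and f2: "f2 \<in> borel_measurable borel" "integrable lborel (\<lambda>x. (cmod (f2 x))\<^sup>2)"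
    and lam: "\<And>l n. n \<ge> 1 \<Longrightarrow> lam l n > 0" "\<And>l. strict_mono_on {1..} (lam l)"
      "\<And>l. (\<lambda>n. lam l n / sqrt (real n)) \<longlonglongrightarrow> a l" "\<And>l. a l < sqrt (pi / \<tau> $ l)"
    and lam': "\<And>l n. n \<ge> 1 \<Longrightarrow> lam' l n > 0" "\<And>l. strict_mono_on {1..} (lam' l)"
      "\<And>l. (\<lambda>n. lam' l n / sqrt (real n)) \<longlonglongrightarrow> b l" "\<And>l. b l < sqrt (\<tau>' $ l / pi)"
    and eq: "\<And>t \<omega>. (\<And>l. t $ l \<in> lam l ` {1..}) \<Longrightarrow> (\<And>l. \<omega> $ l \<in> lam' l ` {1..}) \<Longrightarrow>
      cmod (STFT_ext G f1 (cvec t) (cvec (- (2 * pi) *\<^sub>R \<omega>))) = cmod (STFT_ext G f2 (cvec t) (cvec (- (2 * pi) *\<^sub>R \<omega>)))"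
  shows "cmod (STFT_ext G f1 (cvec t) (cvec w)) = cmod (STFT_ext G f2 (cvec t) (cvec w))"
proof -
  define D where "D t w = STFT_sq G f1 t w - STFT_sq G f2 t w" for t w
  define \<Phi> where "\<Phi> t \<omega> = D (cvec t) (cvec (- (2 * pi) *\<^sub>R \<omega>))" for t \<omega>
  have single: "(\<Sum>l\<in>UNIV. A l * (axis j c $ l)\<^sup>2) = A j * c\<^sup>2" for A :: "'d \<Rightarrow> real" and j c
  proof -
    have "(\<Sum>l\<in>UNIV. A l * (axis j c $ l)\<^sup>2) = (\<Sum>l\<in>UNIV. if l = j then A j * c\<^sup>2 else 0)"
      by (intro sum.cong) (auto simp: axis_def)
    then show ?thesis by simp
  qed
  have grid: "\<Phi> t \<omega> = 0" if "\<And>l. t $ l \<in> lam l ` {1..}" "\<And>l. \<omega> $ l \<in> lam' l ` {1..}" for t \<omega>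
    using eq[OF that] by (simp add: \<Phi>_def D_def STFT_sq_cvec)
  have all_t: "\<Phi> t \<omega> = 0" if \<omega>: "\<And>l. \<omega> $ l \<in> lam' l ` {1..}" for t \<omega>
  proof (rule vanishing_coordinatewise[of "\<lambda>l. lam l ` {1..}" "\<lambda>t. \<Phi> t \<omega>"])
    fix j t assume *: "\<And>r. r \<in> lam j ` {1..} \<Longrightarrow> \<Phi> (\<chi> k. if k = j then r else t $ k) \<omega> = 0"
    \<comment> \<open>Coordinate \<open>j\<close> is cleared so that the line parameter is that
      coordinate and the zeros sit at \<open>lam j n\<close>.\<close>
    define t0 where "t0 = (\<chi> k. if k = j then 0 else t $ k)"
    have line: "t0 + r *\<^sub>R axis j 1 = (\<chi> k. if k = j then r else t $ k)" for r
      by (simp add: t0_def vec_eq_iff axis_def)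
    have "D (cvec (t0 + (t $ j) *\<^sub>R axis j 1)) (cvec (- (2 * pi) *\<^sub>R \<omega> + (t $ j) *\<^sub>R 0)) = 0"
      unfolding D_def
    proof (rule STFT_sq_diff_zero_line[OF G \<tau>' f1 f2 \<tau>[of j] _ lam(1) lam(2-4)[of j]])
      show "\<tau> $ j = (\<Sum>l\<in>UNIV. \<tau> $ l * (axis j 1 $ l)\<^sup>2 + (0 $ l)\<^sup>2 / (4 * \<tau>' $ l))"
        using single[of "($) \<tau>" j 1] by simp
      show "STFT_sq G f1 (cvec (t0 + lam j n *\<^sub>R axis j 1)) (cvec (- (2 * pi) *\<^sub>R \<omega> + lam j n *\<^sub>R 0)) -
         STFT_sq G f2 (cvec (t0 + lam j n *\<^sub>R axis j 1)) (cvec (- (2 * pi) *\<^sub>R \<omega> + lam j n *\<^sub>R 0)) = 0" if "n \<ge> 1" for n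
        using *[of "lam j n"] that by (simp add: line \<Phi>_def D_def)
    qed
    moreover have "t0 + (t $ j) *\<^sub>R axis j 1 = t" unfolding line by (simp add: vec_eq_iff)
    ultimately show "\<Phi> t \<omega> = 0" by (simp add: \<Phi>_def)
  qed (rule grid[OF _ \<omega>])
  have all: "\<Phi> t \<omega> = 0" for t \<omega>
  proof (rule vanishing_coordinatewise[of "\<lambda>l. lam' l ` {1..}" "\<lambda>\<omega>. \<Phi> t \<omega>"])
    fix j \<omega> assume *: "\<And>r. r \<in> lam' j ` {1..} \<Longrightarrow> \<Phi> t (\<chi> k. if k = j then r else \<omega> $ k) = 0"
    define w0 where "w0 = (\<chi> k. if k = j then 0 else - (2 * pi) * \<omega> $ k)"
    have line: "w0 + r *\<^sub>R axis j (- (2 * pi)) = - (2 * pi) *\<^sub>R (\<chi> k. if k = j then r else \<omega> $ k)" for r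
      by (simp add: w0_def vec_eq_iff axis_def)
    \<comment> \<open>This is \<open>(2 * pi)\<^sup>2 / (4 * \<tau>' $ j)\<close>: the rate
      \<open>1 / (4 * \<tau>' $ j)\<close> in \<open>w\<close>, rescaled because the line parameter
      is \<open>\<omega> $ j\<close>. It turns \<open>sqrt (pi / \<sigma>)\<close> into
      \<open>sqrt (\<tau>' $ j / pi)\<close>.\<close>
    define \<sigma> where "\<sigma> = pi\<^sup>2 / \<tau>' $ j"
    have "pi / \<sigma> = \<tau>' $ j / pi" using \<tau>'[of j] by (simp add: \<sigma>_def power2_eq_square)
    then have b: "b j < sqrt (pi / \<sigma>)" using lam'(4)[of j] by simp
    have "\<sigma> > 0" using \<tau>'[of j] by (simp add: \<sigma>_def)
    have "D (cvec (t + (\<omega> $ j) *\<^sub>R 0)) (cvec (w0 + (\<omega> $ j) *\<^sub>R axis j (- (2 * pi)))) = 0"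
      unfolding D_def
    proof (rule STFT_sq_diff_zero_line[OF G \<tau>' f1 f2 \<open>\<sigma> > 0\<close> _ lam'(1) lam'(2,3)[of j] b])
      show "\<sigma> = (\<Sum>l\<in>UNIV. \<tau> $ l * (0 $ l)\<^sup>2 + (axis j (- (2 * pi)) $ l)\<^sup>2 / (4 * \<tau>' $ l))"
        using single[of "\<lambda>l. 1 / (4 * \<tau>' $ l)" j "- (2 * pi)"] by (simp add: \<sigma>_def power_mult_distrib)
      show "STFT_sq G f1 (cvec (t + lam' j n *\<^sub>R 0)) (cvec (w0 + lam' j n *\<^sub>R axis j (- (2 * pi)))) -
         STFT_sq G f2 (cvec (t + lam' j n *\<^sub>R 0)) (cvec (w0 + lam' j n *\<^sub>R axis j (- (2 * pi)))) = 0" if "n \<ge> 1" for n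
        using *[of "lam' j n"] that by (simp add: line \<Phi>_def D_def)
    qed
    moreover have "w0 + (\<omega> $ j) *\<^sub>R axis j (- (2 * pi)) = - (2 * pi) *\<^sub>R \<omega>" unfolding line by (simp add: vec_eq_iff)
    ultimately show "\<Phi> t \<omega> = 0" by (simp add: \<Phi>_def)
  qed (rule all_t)
  have "D (cvec t) (cvec w) = 0"
    using all[of t "- (1 / (2 * pi)) *\<^sub>R w"] by (simp add: \<Phi>_def)
  then have "(cmod (STFT_ext G f1 (cvec t) (cvec w)))\<^sup>2 = (cmod (STFT_ext G f2 (cvec t) (cvec w)))\<^sup>2"
    unfolding D_def STFT_sq_cvec by (metis eq_iff_diff_eq_0 of_real_eq_iff)
  then show ?thesis by (simp add: power2_eq_iff_nonneg)
qed

lemma gauss_entire_cvec_bounded_L2: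
  assumes G: "G \<in> gauss_entire \<tau>' \<tau>" and \<tau>': "\<And>l. \<tau>' $ l > 0"
  shows "\<exists>B. \<forall>x. cmod (G (cvec x)) \<le> B" "integrable lborel (\<lambda>x. (cmod (G (cvec x)))\<^sup>2)"
proof -
  obtain C where C: "C \<ge> 0" "\<And>z. cmod (G z) \<le> C * exp (\<Sum>l\<in>UNIV. \<tau> $ l * (Im (z $ l))\<^sup>2 - \<tau>' $ l * (Re (z $ l))\<^sup>2)"
    using gauss_entire_bound[OF G] by blast
  have bd: "cmod (G (cvec x)) \<le> C * exp (- (\<Sum>l\<in>UNIV. \<tau>' $ l * (x $ l)\<^sup>2))" for x
    using C(2)[of "cvec x"] by (simp add: sum_negf)
  have "cmod (G (cvec x)) \<le> C" for x
  proof -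
    have "exp (- (\<Sum>l\<in>UNIV. \<tau>' $ l * (x $ l)\<^sup>2)) \<le> 1"
      using less_imp_le[OF \<tau>'] by (simp add: sum_nonneg)
    then show ?thesis using bd[of x] mult_left_le[OF _ C(1)] by (meson order_trans)
  qed
  then show "\<exists>B. \<forall>x. cmod (G (cvec x)) \<le> B" by blast
  have cont: "continuous_on UNIV (\<lambda>x. G (cvec x))"
    using G by (intro continuous_on_compose2[OF entire_continuous] linear_continuous_on bounded_linear_cvec) (auto simp: gauss_entire_def)
  have int: "integrable lborel (\<lambda>x::real ^ 'a. C\<^sup>2 * exp (- (\<Sum>l\<in>UNIV. (2 *\<^sub>R \<tau>') $ l * (x $ l)\<^sup>2)))"
    by (intro integrable_mult_right integrable_gaussian_vec) (simp add: \<tau>')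
  show "integrable lborel (\<lambda>x. (cmod (G (cvec x)))\<^sup>2)"
  proof (rule Bochner_Integration.integrable_bound[OF int])
    have "(\<lambda>x. (cmod (G (cvec x)))\<^sup>2) \<in> borel_measurable borel"
      by (intro borel_measurable_continuous_onI continuous_intros cont)
    then show "(\<lambda>x. (cmod (G (cvec x)))\<^sup>2) \<in> borel_measurable lborel" by simp
    have "(cmod (G (cvec x)))\<^sup>2 \<le> C\<^sup>2 * exp (- (\<Sum>l\<in>UNIV. (2 *\<^sub>R \<tau>') $ l * (x $ l)\<^sup>2))" for x
    proof -
      have "(cmod (G (cvec x)))\<^sup>2 \<le> (C * exp (- (\<Sum>l\<in>UNIV. \<tau>' $ l * (x $ l)\<^sup>2)))\<^sup>2"
        by (intro power_mono bd) simp
      then show ?thesis by (simp add: power_mult_distrib exp_double[symmetric] sum_distrib_left mult.assoc)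
    qed
    then show "AE x in lborel. norm ((cmod (G (cvec x)))\<^sup>2) \<le> norm (C\<^sup>2 * exp (- (\<Sum>l\<in>UNIV. (2 *\<^sub>R \<tau>') $ l * (x $ l)\<^sup>2)))"
      by auto
  qed
qed

theorem theorem5p2:
  fixes \<tau> \<tau>' :: "real ^ 'd"
    and g :: "complex ^ 'd \<Rightarrow> complex"
    and lam lam' :: "'d \<Rightarrow> nat \<Rightarrow> real"
    and a b :: "'d \<Rightarrow> real"
  assumes "\<And>l. \<tau> $ l > 0" and "\<And>l. \<tau>' $ l > 0"
    and "g \<in> gauss_entire \<tau>' \<tau>"
    and "g \<noteq> (\<lambda>z. 0)"
    and "\<And>l n. n \<ge> 1 \<Longrightarrow> lam l n > 0" and "\<And>l. strict_mono_on {1..} (lam l)"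
    and "\<And>l n. n \<ge> 1 \<Longrightarrow> lam' l n > 0" and "\<And>l. strict_mono_on {1..} (lam' l)"
    and "\<And>l. (\<lambda>n. lam l n / sqrt (real n)) \<longlonglongrightarrow> a l"
    and "\<And>l. (\<lambda>n. lam' l n / sqrt (real n)) \<longlonglongrightarrow> b l"
    and "\<And>l. a l < sqrt (pi / \<tau> $ l)"
    and "\<And>l. b l < sqrt (\<tau>' $ l / pi)"
  shows "does_phase_retrieval (\<lambda>x. g (complex_vec x 0))
           (product_set (\<lambda>l. sym_range (lam l)) (\<lambda>l. sym_range (lam' l)))"
  unfolding does_phase_retrieval_def
proof (intro ballI impI)
  fix f1 f2 :: "real ^ 'd \<Rightarrow> complex"
  assume f: "f1 \<in> L2_fun" "f2 \<in> L2_fun"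
    and eq: "\<forall>(t, \<omega>)\<in>product_set (\<lambda>l. sym_range (lam l)) (\<lambda>l. sym_range (lam' l)).
      cmod (STFT (\<lambda>x. g (cvec x)) f1 t \<omega>) = cmod (STFT (\<lambda>x. g (cvec x)) f2 t \<omega>)"
  have ent: "entire g" using assms(3) by (simp add: gauss_entire_def)
  have meas: "f1 \<in> borel_measurable lebesgue" "f2 \<in> borel_measurable lebesgue" using f by (auto simp: L2_fun_def)
  obtain h1 where h1: "h1 \<in> borel_measurable borel" "integrable lborel (\<lambda>x. (cmod (h1 x))\<^sup>2)" "AE x in lborel. f1 x = h1 x"
    using L2_fun_borel_representative[OF f(1)] by blast
  obtain h2 where h2: "h2 \<in> borel_measurable borel" "integrable lborel (\<lambda>x. (cmod (h2 x))\<^sup>2)" "AE x in lborel. f2 x = h2 x"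
    using L2_fun_borel_representative[OF f(2)] by blast
  \<comment> \<open>The window occurs conjugated; conjugating its argument too makes it holomorphic
    and leaves its values on real points equal to \<open>cnj (g (cvec x))\<close>.\<close>
  define G where "G z = cnj (g (cnj_vec z))" for z
  have G: "G \<in> gauss_entire \<tau>' \<tau>" unfolding G_def by (rule gauss_entire_cnj[OF assms(3)])
  have STFT: "STFT (\<lambda>x. g (cvec x)) f1 t \<omega> = STFT_ext G h1 (cvec t) (cvec (- (2 * pi) *\<^sub>R \<omega>))"
    "STFT (\<lambda>x. g (cvec x)) f2 t \<omega> = STFT_ext G h2 (cvec t) (cvec (- (2 * pi) *\<^sub>R \<omega>))" for t \<omega>
    unfolding G_def by (rule STFT_eq_STFT_ext[OF meas(1) h1(1,3) ent] STFT_eq_STFT_ext[OF meas(2) h2(1,3) ent])+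
  have mod_eq: "cmod (STFT_ext G h1 (cvec t) (cvec w)) = cmod (STFT_ext G h2 (cvec t) (cvec w))" for t w
  proof (rule STFT_modulus_eq_on_reals[OF G assms(1,2) h1(1,2) h2(1,2) assms(5,6,9,11) assms(7,8,10,12)])
    fix t \<omega> :: "real ^ 'd"
    assume "\<And>l. t $ l \<in> lam l ` {1..}" "\<And>l. \<omega> $ l \<in> lam' l ` {1..}"
    then have "(t, \<omega>) \<in> product_set (\<lambda>l. sym_range (lam l)) (\<lambda>l. sym_range (lam' l))"
      by (fastforce simp: product_set_def sym_range_def)
    with eq show "cmod (STFT_ext G h1 (cvec t) (cvec (- (2 * pi) *\<^sub>R \<omega>))) = cmod (STFT_ext G h2 (cvec t) (cvec (- (2 * pi) *\<^sub>R \<omega>)))"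
      unfolding STFT by blast
  qed
  obtain B where B: "\<And>x. cmod (g (cvec x)) \<le> B"
    using gauss_entire_cvec_bounded_L2(1)[OF assms(3,2)] by blast
  have gL2: "integrable lborel (\<lambda>x. (cmod (g (cvec x)))\<^sup>2)"
    by (rule gauss_entire_cvec_bounded_L2(2)[OF assms(3,2)])
  have "\<exists>c. cmod c = 1 \<and> (AE x in lborel. h1 x = c * h2 x)"
  proof (rule STFT_modulus_determines_phase[where \<gamma> = "\<lambda>x. g (cvec x)"])
    have "continuous_on UNIV (\<lambda>x. g (cvec x))"
      by (intro continuous_on_compose2[OF entire_continuous[OF ent]] linear_continuous_on bounded_linear_cvec) auto
    then show "(\<lambda>x. g (cvec x)) \<in> borel_measurable borel" by (rule borel_measurable_continuous_onI)
    show "cmod (LINT x|lborel. h1 x * cnj (g (cvec (x - t))) * iexp (x \<bullet> w)) = cmod (LINT x|lborel. h2 x * cnj (g (cvec (x - t))) * iexp (x \<bullet> w))" for t w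
      using mod_eq[of t w] unfolding G_def STFT_ext_real .
    show "\<exists>w\<in>U. (LINT u|lborel. cnj (g (cvec (u + s))) * g (cvec u) * iexp (- (u \<bullet> w))) \<noteq> 0" if "open U" "U \<noteq> {}" for s U
      by (rule window_transform_nonzero[OF assms(3,2,4) gL2 that])
  qed (rule h1 h2 gL2 B)+
  then obtain c where c: "cmod c = 1" "AE x in lborel. h1 x = c * h2 x" by blast
  obtain \<alpha> where "c = exp (\<i> * of_real \<alpha>)"
    using complex_unimodular_polar[OF c(1)] by (metis cis_conv_exp cis.code)
  moreover have "AE x in lborel. f1 x = c * f2 x"
    using c(2) h1(3) h2(3) by eventually_elim simp
  ultimately show "\<exists>\<alpha>::real. AE x in lebesgue. f1 x = exp (\<i> * of_real \<alpha>) * f2 x"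
    using AE_completion by blast
qed

end
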